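(* Fix $N\ge1$. For each $M\ge1$ let $m_M\in\mathcal{M}_M$ be a configuration of the mean-field network $\nabla_M^N$ (with $NM$ customers in total), and let $\nu_M(t)$ be the law at time $t$ of the Markov process $\nabla_M^N$ started at $m_M$, i.e. $\nu_M(0)=\delta_{m_M}$. Suppose that $m_M$ converges weakly, as $M\to\infty$, to a probability measure $\nu$ on $(\frac1N\mathbb{Z}_{\ge0})^5$. Then for every $t\ge0$ the laws $\nu_M(t)$ (probability measures on the space of probability measures on $(\frac1N\mathbb{Z}_{\ge0})^5$ with the weak topology) converge weakly as $M\to\infty$ to the point mass $\delta_{\nu(t)}$, where $\nu(t)$ is the evolution of the Non-Linear Markov Process $\nabla_\infty^N$ with $\nu(0)=\nu$.
   Context: **Network $\nabla_M^N$.** There are $3M$ nodes $\bar O_i,\bar A_i,\bar B_i$, $i=1,\dots,M$, and $NM$ customers. Nodes $\bar O_i$ hold customers of class $O$; nodes $\bar A_i$ hold customers of classes $A$ and $BA$; nodes $\bar B_i$ hold customers of classes $B$ and $AB$. Service times are exponential with rates $\gamma_O=3$, $\gamma_A=\gamma_B=10$, $\gamma_{AB}=\gamma_{BA}=2$; each node serves one customer at a time. In $\bar A_i$ the $BA$ customers have preemptive priority over $A$ customers; in $\bar B_i$ the $AB$ customers have preemptive priority over $B$ customers. A customer served at some $\bar O_i$ moves to one of the $2M$ nodes $\bar A_j,\bar B_j$ chosen uniformly, becoming class $A$ (at $\bar A_j$) or $B$ (at $\bar B_j$). A served $A$ customer moves to a uniformly chosen $\bar B_j$ with class $AB$; a served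 $B$ customer moves to a uniformly chosen $\bar A_j$ with class $BA$; a served $AB$ or $BA$ customer moves to a uniformly chosen $\bar O_j$ with class $O$. This is a continuous-time Markov chain; by symmetry it is described by the Markov process of the product measure $\mu_O\times\mu_{\bar A}\times\mu_{\bar B}$ on $(\frac1N\mathbb{Z}_{\ge0})^5$, where $\mu_O,\mu_{\bar A},\mu_{\bar B}$ are the empirical measures (weights $1/M$) over the $M$ nodes of each type of the numbers of customers of each class divided by $N$. $\mathcal{M}_M$ is the set of all such measures. **Non-Linear Markov Process $\nabla_\infty^N$.** Classes $a\in\{O,A,B,AB,BA\}$, basis vectors $e_a$ of $\mathbb{Z}^5$. Its states are probability measures on $(\frac1N\mathbb{Z}_{\ge0})^5$; write $\nu_t(n)$, $n\in\mathbb{Z}_{\ge0}^5$, for the mass at $n/N$. Let $s_O(n)=3\cdot 1_{\{n_O>0\}}$, $s_{AB}(n)=2\cdot 1_{\{n_{AB}>0\}}$, $s_{BA}(n)=2\cdot 1_{\{n_{BA}>0\}}$, $s_A(n)=10\cdot 1_{\{n_A>0,\,n_{BA}=0\}}$, $s_B(n)=10\cdot 1_{\{n_B>0,\,n_{AB}=0\}}$. Put $\lambda_a(t)=\sum_n s_a(n)\nu_t(n)$ and $r_O=\lambda_{AB}+\lambda_{BA}$, $r_A=r_B=\lambda_O/2$, $r_{AB}=\lambda_A$, $r_{BA}=\lambda_B$. The evolution is the unique solution, with the given initial measure, of $$\frac{d\nu_t(n)}{dt}=-\nu_t(n)\sum_a\big(r_a(t)+s_a(n)\big)+\sum_a\nu_t(n-e_a)r_a(t)+\sum_a\nu_t(n+e_a)s_a(n+e_a),$$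 where $\nu_t(m)=0$ if $m$ has a negative coordinate. *)

theory Defs
  imports "HOL-Probability.Probability"
begin

subsection \<open>Weak convergence\<close>

definition borel_of :: "'a topology \<Rightarrow> 'a measure" where
  "borel_of T = sigma (topspace T) {U. openin T U}"

definition bounded_continuous :: "'a topology \<Rightarrow> ('a \<Rightarrow> real) \<Rightarrow> bool" where
  "bounded_continuous T f \<longleftrightarrow> continuous_map T euclideanreal f \<and> bounded (f ` topspace T)"

definition weakly_converges ::
    "'a topology \<Rightarrow> (nat \<Rightarrow> 'a measure) \<Rightarrow> 'a measure \<Rightarrow> bool" where
  "weakly_converges T \<mu> \<mu>' \<longleftrightarrow>
     (\<forall>f. bounded_continuous T f \<longrightarrow> (\<lambda>k. \<integral>x. f x \<partial>\<mu> k) \<longlonglongrightarrow> (\<integral>x. f x \<partial>\<mu>'))"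

text \<open>
  The weak topology on the discrete probability measures carried by \<open>topspace T\<close>. It is only used
  over a countable space, where all probability measures are of this kind.
\<close>

definition weak_topology :: "'a topology \<Rightarrow> 'a pmf topology" where
  "weak_topology T = topology_generated_by
     {{p. set_pmf p \<subseteq> topspace T \<and> measure_pmf.expectation p f \<in> U} | f U.
        bounded_continuous T f \<and> open U}"


subsection \<open>Continuous-time Markov chains on a finite state set\<close>

definition generator :: "'s set \<Rightarrow> ('s \<Rightarrow> 's \<Rightarrow> real) \<Rightarrow> 's \<Rightarrow> 's \<Rightarrow> real" where
  "generator S q x y = (if x = y then - (\<Sum>z\<in>S - {x}. q x z) else q x y)"

definition transition_semigroup ::
    "'s set \<Rightarrow> ('s \<Rightarrow> 's \<Rightarrow> real) \<Rightarrow> (real \<Rightarrow> 's \<Rightarrow> 's \<Rightarrow> real) \<Rightarrow> bool" where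
  "transition_semigroup S q P \<longleftrightarrow>
     (\<forall>x\<in>S. \<forall>y\<in>S. P 0 x y = (if x = y then 1 else 0)) \<and>
     (\<forall>h\<ge>0. \<forall>x\<in>S. (\<forall>y\<in>S. 0 \<le> P h x y) \<and> (\<Sum>y\<in>S. P h x y) = 1) \<and>
     (\<forall>g\<ge>0. \<forall>h\<ge>0. \<forall>x\<in>S. \<forall>y\<in>S. P (g + h) x y = (\<Sum>z\<in>S. P g x z * P h z y)) \<and>
     (\<forall>x\<in>S. \<forall>y\<in>S. ((\<lambda>h. P h x y) has_real_derivative generator S q x y) (at 0 within {0..}))"

text \<open>
  A right-continuous, time-homogeneous Markov process with jump rates \<open>q\<close>. The last conjunct is
  the Markov property \<open>P(X(t\<^sub>n + h) = y | X(t\<^sub>0) = x\<^sub>0, \<dots>, X(t\<^sub>n) = x\<^sub>n) = P\<^sub>h(x\<^sub>n, y)\<close>, multiplied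
  out so that conditions of probability zero need no exception.
\<close>

definition markov_chain ::
    "'s set \<Rightarrow> ('s \<Rightarrow> 's \<Rightarrow> real) \<Rightarrow> 'w measure \<Rightarrow> (real \<Rightarrow> 'w \<Rightarrow> 's) \<Rightarrow> bool" where
  "markov_chain S q \<Omega> X \<longleftrightarrow>
     prob_space \<Omega> \<and>
     (\<forall>t\<ge>0. X t \<in> measurable \<Omega> (count_space S)) \<and>
     (\<forall>\<omega>\<in>space \<Omega>. \<forall>t\<ge>0. \<forall>\<^sub>F u in at_right t. X u \<omega> = X t \<omega>) \<and>
     (\<exists>P. transition_semigroup S q P \<and>
        (\<forall>(n::nat) (ts::nat \<Rightarrow> real) xs h y.
           0 \<le> ts 0 \<and> (\<forall>i<n. ts i < ts (Suc i)) \<and> 0 \<le> h \<and> (\<forall>i\<le>n. xs i \<in> S) \<and> y \<in> S \<longrightarrow>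
           measure \<Omega> {\<omega>\<in>space \<Omega>. (\<forall>i\<le>n. X (ts i) \<omega> = xs i) \<and> X (ts n + h) \<omega> = y} =
           measure \<Omega> {\<omega>\<in>space \<Omega>. \<forall>i\<le>n. X (ts i) \<omega> = xs i} * P h (xs n) y))"


subsection \<open>Classes and service rates\<close>

datatype cls = cO | cA | cB | cAB | cBA

lemma UNIV_cls: "(UNIV :: cls set) = {cO, cA, cB, cAB, cBA}"
  using cls.exhaust by auto

instance cls :: finite
  by standard (simp add: UNIV_cls)

fun service :: "cls \<Rightarrow> (cls \<Rightarrow> nat) \<Rightarrow> real" where
  "service cO n = (if n cO > 0 then 3 else 0)"
| "service cA n = (if n cA > 0 \<and> n cBA = 0 then 10 else 0)"
| "service cB n = (if n cB > 0 \<and> n cAB = 0 then 10 else 0)"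
| "service cAB n = (if n cAB > 0 then 2 else 0)"
| "service cBA n = (if n cBA > 0 then 2 else 0)"

text \<open>\<open>scaled N n\<close> is the point \<open>n/N\<close> of \<open>(1/N \<int>\<^sub>\<ge>\<^sub>0)\<^sup>5\<close>.\<close>

definition scaled :: "nat \<Rightarrow> (cls \<Rightarrow> nat) \<Rightarrow> real ^ cls" where
  "scaled N n = (\<chi> a. real (n a) / real N)"

definition lattice_top :: "nat \<Rightarrow> (real ^ cls) topology" where
  "lattice_top N = top_of_set (range (scaled N))"


subsection \<open>The network\<close>

text \<open>
  In a configuration \<open>k\<close>, the number \<open>k i a\<close> counts the customers of class \<open>a\<close> at the \<open>i\<close>-th node
  of the type that holds class \<open>a\<close>, for \<open>i < M\<close>; so \<open>k i\<close> collects the contents of the three nodes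
  \<open>O\<^sub>i\<close>, \<open>A\<^sub>i\<close>, \<open>B\<^sub>i\<close>. As \<open>service a n\<close> only looks at the classes sharing a node with \<open>a\<close>,
  \<open>service a (k i)\<close> is the rate at which that node completes service of a class \<open>a\<close> customer.
\<close>

type_synonym config = "nat \<Rightarrow> cls \<Rightarrow> nat"

definition configs :: "nat \<Rightarrow> nat \<Rightarrow> config set" where
  "configs N M = {k. (\<forall>i\<ge>M. \<forall>a. k i a = 0) \<and> (\<Sum>i<M. \<Sum>a\<in>UNIV. k i a) = N * M}"

text \<open>The probability that a served customer of class \<open>a\<close> becomes a customer of class \<open>b\<close>; the
  node it joins is then uniform among the \<open>M\<close> nodes holding class \<open>b\<close>.\<close>

fun route :: "cls \<Rightarrow> cls \<Rightarrow> real" where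
  "route cO b = (if b = cA \<or> b = cB then 1 / 2 else 0)"
| "route cA b = (if b = cAB then 1 else 0)"
| "route cB b = (if b = cBA then 1 else 0)"
| "route cAB b = (if b = cO then 1 else 0)"
| "route cBA b = (if b = cO then 1 else 0)"

definition move :: "nat \<Rightarrow> cls \<Rightarrow> nat \<Rightarrow> cls \<Rightarrow> config \<Rightarrow> config" where
  "move i a j b k =
     (let k' = k(i := (k i)(a := k i a - 1)) in k'(j := (k' j)(b := k' j b + 1)))"

definition jump_rate :: "nat \<Rightarrow> config \<Rightarrow> config \<Rightarrow> real" where
  "jump_rate M k k' = (\<Sum>i<M. \<Sum>a\<in>UNIV. \<Sum>j<M. \<Sum>b\<in>UNIV.
     if k' = move i a j b k then service a (k i) * route a b / real M else 0)"

definition \<mu>\<^sub>O :: "nat \<Rightarrow> nat \<Rightarrow> config \<Rightarrow> real pmf" where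
  "\<mu>\<^sub>O N M k = map_pmf (\<lambda>i. real (k i cO) / real N) (pmf_of_set {..<M})"

definition \<mu>\<^sub>A :: "nat \<Rightarrow> nat \<Rightarrow> config \<Rightarrow> (real \<times> real) pmf" where
  "\<mu>\<^sub>A N M k = map_pmf (\<lambda>i. (real (k i cA) / real N, real (k i cBA) / real N)) (pmf_of_set {..<M})"

definition \<mu>\<^sub>B :: "nat \<Rightarrow> nat \<Rightarrow> config \<Rightarrow> (real \<times> real) pmf" where
  "\<mu>\<^sub>B N M k = map_pmf (\<lambda>i. (real (k i cB) / real N, real (k i cAB) / real N)) (pmf_of_set {..<M})"

definition assemble :: "real \<times> (real \<times> real) \<times> (real \<times> real) \<Rightarrow> real ^ cls" where
  "assemble = (\<lambda>(x\<^sub>O, (x\<^sub>A, x\<^sub>B\<^sub>A), (x\<^sub>B, x\<^sub>A\<^sub>B)).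
     \<chi> a. case a of cO \<Rightarrow> x\<^sub>O | cA \<Rightarrow> x\<^sub>A | cB \<Rightarrow> x\<^sub>B | cAB \<Rightarrow> x\<^sub>A\<^sub>B | cBA \<Rightarrow> x\<^sub>B\<^sub>A)"

definition empirical :: "nat \<Rightarrow> nat \<Rightarrow> config \<Rightarrow> (real ^ cls) pmf" where
  "empirical N M k = map_pmf assemble (pair_pmf (\<mu>\<^sub>O N M k) (pair_pmf (\<mu>\<^sub>A N M k) (\<mu>\<^sub>B N M k)))"

definition empirical_measures :: "nat \<Rightarrow> nat \<Rightarrow> (real ^ cls) pmf set" where
  "empirical_measures N M = empirical N M ` configs N M"

text \<open>
  The law at time \<open>t\<close> of the measure-valued process described by the configuration process \<open>X\<close>, as
  a probability measure on the space of probability measures with its weak topology.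
\<close>

definition network_law ::
    "nat \<Rightarrow> nat \<Rightarrow> 'w measure \<Rightarrow> (real \<Rightarrow> 'w \<Rightarrow> config) \<Rightarrow> real \<Rightarrow> (real ^ cls) pmf measure" where
  "network_law N M \<Omega> X t =
     distr \<Omega> (borel_of (weak_topology (lattice_top N))) (\<lambda>\<omega>. empirical N M (X t \<omega>))"

text \<open>
  Different configurations with the same empirical measure \<open>m\<close> differ by permutations of the nodes
  of each type, so any of them, possibly chosen at random, may represent the initial state \<open>m\<close>.
\<close>

definition network_process ::
    "nat \<Rightarrow> nat \<Rightarrow> (real ^ cls) pmf \<Rightarrow> 'w measure \<Rightarrow> (real \<Rightarrow> 'w \<Rightarrow> config) \<Rightarrow> bool" where
  "network_process N M m \<Omega> X \<longleftrightarrow>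
     markov_chain (configs N M) (jump_rate M) \<Omega> X \<and> (AE \<omega> in \<Omega>. empirical N M (X 0 \<omega>) = m)"


subsection \<open>The non-linear Markov process\<close>

definition mass :: "nat \<Rightarrow> (real ^ cls) pmf \<Rightarrow> (cls \<Rightarrow> nat) \<Rightarrow> real" where
  "mass N p n = pmf p (scaled N n)"

definition departure :: "nat \<Rightarrow> (real ^ cls) pmf \<Rightarrow> cls \<Rightarrow> real" where
  "departure N p a = (\<Sum>\<^sub>\<infinity>n. service a n * mass N p n)"

fun arrival :: "nat \<Rightarrow> (real ^ cls) pmf \<Rightarrow> cls \<Rightarrow> real" where
  "arrival N p cO = departure N p cAB + departure N p cBA"
| "arrival N p cA = departure N p cO / 2"
| "arrival N p cB = departure N p cO / 2"
| "arrival N p cAB = departure N p cA"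
| "arrival N p cBA = departure N p cB"

definition drift :: "nat \<Rightarrow> (real ^ cls) pmf \<Rightarrow> (cls \<Rightarrow> nat) \<Rightarrow> real" where
  "drift N p n =
     - mass N p n * (\<Sum>a\<in>UNIV. arrival N p a + service a n)
     + (\<Sum>a\<in>UNIV. if n a = 0 then 0 else mass N p (n(a := n a - 1)) * arrival N p a)
     + (\<Sum>a\<in>UNIV. mass N p (n(a := n a + 1)) * service a (n(a := n a + 1)))"

definition nonlinear_evolution ::
    "nat \<Rightarrow> (real ^ cls) pmf \<Rightarrow> (real \<Rightarrow> (real ^ cls) pmf) \<Rightarrow> bool" where
  "nonlinear_evolution N \<nu>\<^sub>0 \<nu> \<longleftrightarrow>
     \<nu> 0 = \<nu>\<^sub>0 \<and>
     (\<forall>t\<ge>0. set_pmf (\<nu> t) \<subseteq> range (scaled N)) \<and>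
     (\<forall>t\<ge>0. \<forall>n. ((\<lambda>u. mass N (\<nu> u) n) has_real_derivative drift N (\<nu> t) n) (at t within {0..}))"

end

(*
The empirical measure and the solution are compared in expected l1 distance. As routing always
leads to a node of another type, the generator of the network, applied to the mass that the product
of the three empirical measures puts on a lattice point, is the drift of the non-linear process at
this product up to O(1/M), and the quadratic variation is O(1/M) as well. The drift is Lipschitz
for the l1 distance, so Gronwall's inequality applies to the expected l1 distance between the
empirical measure and the solution. The distance is smoothed, and truncated to a finite set of
lattice points; the truncation is harmless because for probability measures the l1 distance is at
most 2 * (sum over F of |p - q|) + 2 * q(-F), which only involves the tightness of the solution q.
*)

theory Submission
  imports Defs
begin


text \<open>The network is handled as a chain on the finite set of configurations, and only its
  one-time laws enter. They satisfy the forward equation, so expectations of functions of the state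
  are differentiated directly, without martingales or path estimates. The limit is deterministic by
  a count: a jump touches a fraction of order 1/M of the triples of nodes, so it changes each mass
  by O(1/M), while the total jump rate is O(M); second-order effects are of order M * (1/M)^2. The
  obstacle is that the l1 distance is neither smooth nor a finite sum. Smoothing by \<delta> on a
  finite set F costs card F * \<delta> at time 0, and a term of order card F / (\<delta> * M) in the
  growth rate. This is affordable because the Gronwall constant depends neither on F nor on
  \<delta>. The order of the choices is therefore: tail error \<epsilon>, a set F good for the whole
  interval [0,T], smoothing \<delta>, and last M. Finite F also suits the initial data, whose weak
  convergence is used as convergence of each single mass.\<close>

no_notation Infinite_Sum.abs_summable_on (infixr \<open>abs'_summable'_on\<close> 46)

section \<open>The l1 distance of discrete distributions\<close>

definition l1_dist :: "'a pmf \<Rightarrow> 'a pmf \<Rightarrow> real" where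
  "l1_dist p q = (\<Sum>\<^sub>\<infinity>x. \<bar>pmf p x - pmf q x\<bar>)"

lemma pmf_summable_on: "pmf p summable_on A"
  by (meson abs_summable_equivalent abs_summable_summable pmf_abs_summable)

lemma infsum_pmf_UNIV: "(\<Sum>\<^sub>\<infinity>x. pmf p x) = 1"
  by (metis infsetsum_infsum infsetsum_pmf_eq_1 pmf_abs_summable subset_UNIV)

lemma l1_dist_summable: "(\<lambda>x. \<bar>pmf p x - pmf q x\<bar>) summable_on A"
proof (rule summable_on_comparison_test)
  show "(\<lambda>x. pmf p x + pmf q x) summable_on A"
    by (intro summable_on_add pmf_summable_on)
  show "\<bar>pmf p x - pmf q x\<bar> \<le> pmf p x + pmf q x" for x
    using pmf_nonneg[of p x] pmf_nonneg[of q x] by linarith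
qed simp

lemma sum_le_l1_dist: "finite F \<Longrightarrow> (\<Sum>x\<in>F. \<bar>pmf p x - pmf q x\<bar>) \<le> l1_dist p q"
  unfolding l1_dist_def by (intro finite_sum_le_infsum l1_dist_summable) auto

lemma l1_dist_nonneg: "0 \<le> l1_dist p q"
  unfolding l1_dist_def by (intro infsum_nonneg) auto

lemma infsum_pmf_Compl:
  assumes "finite F"
  shows "(\<Sum>\<^sub>\<infinity>x\<in>-F. pmf p x) = 1 - (\<Sum>x\<in>F. pmf p x)"
proof -
  have "(\<Sum>\<^sub>\<infinity>x\<in>F \<union> -F. pmf p x) = (\<Sum>\<^sub>\<infinity>x\<in>F. pmf p x) + (\<Sum>\<^sub>\<infinity>x\<in>-F. pmf p x)"
    by (intro infsum_Un_disjoint pmf_summable_on) auto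
  then show ?thesis
    using assms by (simp add: infsum_pmf_UNIV)
qed

text \<open>Outside \<open>F\<close> the terms are at most \<open>pmf p x + pmf q x\<close>, which
  sum to the two tail masses. As both total masses are 1, the tail of \<open>p\<close> exceeds that
  of \<open>q\<close> by at most the distance on \<open>F\<close>. Control of \<open>p\<close> on
  \<open>F\<close> therefore suffices.\<close>

lemma l1_dist_le_truncated:
  assumes F: "finite F"
  shows "l1_dist p q \<le> 2 * (\<Sum>x\<in>F. \<bar>pmf p x - pmf q x\<bar>) + 2 * (1 - (\<Sum>x\<in>F. pmf q x))"
proof -
  have "l1_dist p q = (\<Sum>x\<in>F. \<bar>pmf p x - pmf q x\<bar>) + (\<Sum>\<^sub>\<infinity>x\<in>-F. \<bar>pmf p x - pmf q x\<bar>)"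
    using infsum_Un_disjoint[OF l1_dist_summable[of p q F] l1_dist_summable[of p q "-F"]] F
    by (simp add: l1_dist_def)
  moreover have "(\<Sum>\<^sub>\<infinity>x\<in>-F. \<bar>pmf p x - pmf q x\<bar>) \<le> (\<Sum>\<^sub>\<infinity>x\<in>-F. pmf p x + pmf q x)"
  proof (intro infsum_mono l1_dist_summable summable_on_add pmf_summable_on)
    show "\<bar>pmf p x - pmf q x\<bar> \<le> pmf p x + pmf q x" for x
      using pmf_nonneg[of p x] pmf_nonneg[of q x] by linarith
  qed
  moreover have "(\<Sum>\<^sub>\<infinity>x\<in>-F. pmf p x + pmf q x)
      = (1 - (\<Sum>x\<in>F. pmf p x)) + (1 - (\<Sum>x\<in>F. pmf q x))"
    using F by (simp add: infsum_add pmf_summable_on infsum_pmf_Compl)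
  moreover have "(\<Sum>x\<in>F. pmf q x) - (\<Sum>x\<in>F. pmf p x) \<le> (\<Sum>x\<in>F. \<bar>pmf p x - pmf q x\<bar>)"
    unfolding sum_subtractf[symmetric] by (intro sum_mono) auto
  ultimately show ?thesis by argo
qed

lemma summable_on_times_pmf:
  fixes f :: "'a \<Rightarrow> real"
  assumes "\<And>x. \<bar>f x\<bar> \<le> B"
  shows "(\<lambda>x. f x * pmf p x) summable_on A"
proof -
  have "(\<lambda>x. norm (f x * pmf p x)) summable_on A"
  proof (rule summable_on_comparison_test)
    show "(\<lambda>x. B * pmf p x) summable_on A"
      by (intro summable_on_cmult_right pmf_summable_on)
    show "norm (f x * pmf p x) \<le> B * pmf p x" for x
      using assms[of x] by (simp add: abs_mult mult_right_mono)
  qed simp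
  then show ?thesis by (rule abs_summable_summable)
qed

lemma expectation_eq_infsum:
  fixes f :: "'a \<Rightarrow> real"
  assumes "\<And>x. \<bar>f x\<bar> \<le> B"
  shows "measure_pmf.expectation p f = (\<Sum>\<^sub>\<infinity>x. f x * pmf p x)"
proof -
  have *: "(\<lambda>x. pmf p x * f x) abs_summable_on UNIV"
  proof (rule Infinite_Set_Sum.abs_summable_on_comparison_test)
    show "(\<lambda>x. B * pmf p x) abs_summable_on UNIV"
      using pmf_abs_summable by (rule abs_summable_on_cmult_right)
    show "norm (pmf p x * f x) \<le> norm (B * pmf p x)" for x
      using assms[of x] by (simp add: abs_mult mult.commute mult_right_mono)
  qed
  then show ?thesis
    unfolding pmf_expectation_eq_infsetsum by (simp add: infsetsum_infsum mult.commute)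
qed

text \<open>Serves both the Lipschitz bound for the departure rates, with \<open>B = 10\<close>, and
  the comparison with the weak topology.\<close>

lemma expectation_diff_le_l1_dist:
  fixes f :: "'a \<Rightarrow> real"
  assumes "\<And>x. \<bar>f x\<bar> \<le> B"
  shows "\<bar>measure_pmf.expectation p f - measure_pmf.expectation q f\<bar> \<le> B * l1_dist p q"
proof -
  have "measure_pmf.expectation p f - measure_pmf.expectation q f
      = (\<Sum>\<^sub>\<infinity>x. f x * pmf p x - f x * pmf q x)"
    unfolding expectation_eq_infsum[OF assms]
    using infsum_add[OF summable_on_times_pmf[OF assms, where A=UNIV and p=p]
        summable_on_uminus[THEN iffD2, OF summable_on_times_pmf[OF assms, where A=UNIV and p=q]]]
    by (simp add: infsum_uminus)
  also have "\<bar>\<dots>\<bar> \<le> (\<Sum>\<^sub>\<infinity>x. B * \<bar>pmf p x - pmf q x\<bar>)"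
  proof -
    have bd: "norm (f x * pmf p x - f x * pmf q x) \<le> B * \<bar>pmf p x - pmf q x\<bar>" for x
      using assms[of x] by (simp add: abs_mult mult_right_mono flip: right_diff_distrib)
    have "(\<lambda>x. norm (f x * pmf p x - f x * pmf q x)) summable_on UNIV"
      by (rule summable_on_comparison_test[OF summable_on_cmult_right[OF l1_dist_summable] bd]) simp
    then have "norm (\<Sum>\<^sub>\<infinity>x. f x * pmf p x - f x * pmf q x)
        \<le> (\<Sum>\<^sub>\<infinity>x. norm (f x * pmf p x - f x * pmf q x))"
      by (rule norm_infsum_bound)
    also have "\<dots> \<le> (\<Sum>\<^sub>\<infinity>x. B * \<bar>pmf p x - pmf q x\<bar>)"
      by (intro infsum_mono summable_on_cmult_right l1_dist_summable bd) fact
    finally show ?thesis by simp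
  qed
  also have "\<dots> = B * l1_dist p q"
    unfolding l1_dist_def by (rule infsum_cmult_right) (rule l1_dist_summable)
  finally show ?thesis .
qed


section \<open>Triples of nodes and the empirical measure\<close>

text \<open>
  The product of the three empirical measures is uniform over the \<open>M\<^sup>3\<close> triples consisting of one
  node of each type.
\<close>

type_synonym triple = "nat \<times> nat \<times> nat"

fun node_index :: "triple \<Rightarrow> cls \<Rightarrow> nat" where
  "node_index (i\<^sub>O, i\<^sub>A, i\<^sub>B) cO = i\<^sub>O"
| "node_index (i\<^sub>O, i\<^sub>A, i\<^sub>B) cA = i\<^sub>A"
| "node_index (i\<^sub>O, i\<^sub>A, i\<^sub>B) cBA = i\<^sub>A"
| "node_index (i\<^sub>O, i\<^sub>A, i\<^sub>B) cB = i\<^sub>B"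
| "node_index (i\<^sub>O, i\<^sub>A, i\<^sub>B) cAB = i\<^sub>B"

definition triples :: "nat \<Rightarrow> triple set" where
  "triples M = {..<M} \<times> {..<M} \<times> {..<M}"

definition contents :: "config \<Rightarrow> triple \<Rightarrow> cls \<Rightarrow> nat" where
  "contents k \<iota> a = k (node_index \<iota> a) a"

text \<open>Counts stay integers here: \<open>scaled N\<close> is injective for
  \<open>N \<ge> 1\<close>, so masses are the same before and after scaling and the estimates are
  free of the factor \<open>1 / N\<close>.\<close>

definition contents_pmf :: "nat \<Rightarrow> config \<Rightarrow> (cls \<Rightarrow> nat) pmf" where
  "contents_pmf M k = map_pmf (contents k) (pmf_of_set (triples M))"

definition avg :: "nat \<Rightarrow> config \<Rightarrow> ((cls \<Rightarrow> nat) \<Rightarrow> real) \<Rightarrow> real" where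
  "avg M k g = (\<Sum>\<iota>\<in>triples M. g (contents k \<iota>)) / real M ^ 3"

lemma finite_triples [simp]: "finite (triples M)"
  by (simp add: triples_def)

lemma card_triples: "card (triples M) = M ^ 3"
  by (simp add: triples_def power3_eq_cube)

lemma triples_nonempty: "M \<ge> 1 \<Longrightarrow> triples M \<noteq> {}"
  by (auto simp: triples_def lessThan_empty_iff)

lemma node_index_less: "\<iota> \<in> triples M \<Longrightarrow> node_index \<iota> a < M"
  by (cases \<iota>; cases a) (auto simp: triples_def)

lemma sum_UNIV_cls: "(\<Sum>a\<in>UNIV. f a) = f cO + f cA + f cB + f cAB + f cBA"
  by (simp add: UNIV_cls add.assoc)

lemma card_cls: "CARD(cls) = 5"
  by (simp add: UNIV_cls)

lemma inj_scaled: "N \<ge> 1 \<Longrightarrow> inj (scaled N)"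
  by (rule injI) (auto simp: scaled_def vec_eq_iff fun_eq_iff)

lemma pair_pmf_of_set:
  assumes "finite A" "A \<noteq> {}" "finite B" "B \<noteq> {}"
  shows "pair_pmf (pmf_of_set A) (pmf_of_set B) = pmf_of_set (A \<times> B)"
proof (rule pmf_eqI)
  show "pmf (pair_pmf (pmf_of_set A) (pmf_of_set B)) x = pmf (pmf_of_set (A \<times> B)) x" for x
    using assms
    by (cases x) (simp add: pmf_pair indicator_def card_cartesian_product)
qed

lemma empirical_eq:
  assumes "M \<ge> 1"
  shows "empirical N M k = map_pmf (scaled N) (contents_pmf M k)"
proof -
  have ne: "{..<M} \<noteq> {}" using assms by (auto simp: lessThan_empty_iff)
  have "pmf_of_set (triples M) =
      pair_pmf (pmf_of_set {..<M}) (pair_pmf (pmf_of_set {..<M}) (pmf_of_set {..<M}))"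
    using ne by (simp add: triples_def pair_pmf_of_set)
  moreover have "scaled N (contents k (h, i, j)) =
      assemble (real (k h cO) / real N, (real (k i cA) / real N, real (k i cBA) / real N),
        (real (k j cB) / real N, real (k j cAB) / real N))" for h i j
    by (auto simp: scaled_def assemble_def contents_def vec_eq_iff split: cls.splits)
  ultimately show ?thesis
    by (simp add: empirical_def \<mu>\<^sub>O_def \<mu>\<^sub>A_def \<mu>\<^sub>B_def contents_pmf_def map_pair[symmetric]
        map_pmf_comp case_prod_unfold)
      (intro map_pmf_cong, auto)
qed

lemma mass_map_scaled: "N \<ge> 1 \<Longrightarrow> mass N (map_pmf (scaled N) q) n = pmf q n"
  by (simp add: mass_def pmf_map_inj' inj_scaled)

lemma expectation_contents_pmf:
  assumes "M \<ge> 1"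
  shows "measure_pmf.expectation (contents_pmf M k) g = avg M k g"
  using assms triples_nonempty
  by (simp add: contents_pmf_def avg_def integral_pmf_of_set card_triples)

lemma pmf_contents_pmf:
  assumes "M \<ge> 1"
  shows "pmf (contents_pmf M k) n = avg M k (indicator {n})"
  unfolding expectation_contents_pmf[OF assms, symmetric] by (simp add: pmf.rep_eq)

lemma avg_add: "avg M k (\<lambda>c. f c + g c) = avg M k f + avg M k g"
  by (simp add: avg_def sum.distrib add_divide_distrib)

lemma avg_diff: "avg M k (\<lambda>c. f c - g c) = avg M k f - avg M k g"
  by (simp add: avg_def sum_subtractf diff_divide_distrib)

lemma avg_sum: "avg M k (\<lambda>c. \<Sum>a\<in>A. f a c) = (\<Sum>a\<in>A. avg M k (f a))"
  unfolding avg_def by (subst sum.swap) (simp add: sum_divide_distrib)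

lemma avg_cmult: "avg M k (\<lambda>c. x * f c) = x * avg M k f"
  by (simp add: avg_def sum_distrib_left)

lemma service_nonneg: "0 \<le> service a n"
  by (cases a) auto

lemma service_le: "service a n \<le> 10"
  by (cases a) auto

lemma abs_service_le: "\<bar>service a n\<bar> \<le> 10"
  using service_nonneg[of a n] service_le[of a n] by simp

lemma service_pos_imp: "service a n \<noteq> 0 \<Longrightarrow> n a > 0"
  by (cases a) (auto split: if_splits)

lemma route_nonneg: "0 \<le> route a b"
  by (cases a) auto

lemma sum_route: "(\<Sum>b\<in>UNIV. route a b) = 1"
  by (cases a) (auto simp: sum_UNIV_cls)

lemma route_neq: "route a b \<noteq> 0 \<Longrightarrow> a \<noteq> b"
  by (cases a; cases b) auto

text \<open>Priority only compares classes held by the same node, and a triple takes both of them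
  from that node; so combining nodes of different types does not alter a rate.\<close>

lemma service_contents: "service a (contents k \<iota>) = service a (k (node_index \<iota> a))"
  by (cases \<iota>; cases a) (auto simp: contents_def)

lemma departure_map_scaled:
  assumes "N \<ge> 1"
  shows "departure N (map_pmf (scaled N) q) a = measure_pmf.expectation q (service a)"
  unfolding departure_def mass_map_scaled[OF assms]
  by (rule expectation_eq_infsum[OF abs_service_le, symmetric])

lemma departure_nonneg:
  assumes "N \<ge> 1"
  shows "0 \<le> departure N (map_pmf (scaled N) q) a"
  unfolding departure_map_scaled[OF assms] by (simp add: service_nonneg)

lemma departure_le:
  assumes "N \<ge> 1"
  shows "departure N (map_pmf (scaled N) q) a \<le> 10"
proof -
  have "integrable (measure_pmf q) (service a)"
    by (rule measure_pmf.integrable_const_bound[where B=10]) (auto simp: abs_service_le)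
  then show ?thesis
    unfolding departure_map_scaled[OF assms]
    by (intro measure_pmf.integral_le_const) (auto simp: service_le)
qed

lemma arrival_eq: "arrival N p b = (\<Sum>a\<in>UNIV. departure N p a * route a b)"
  by (cases b) (auto simp: sum_UNIV_cls)

lemma arrival_nonneg: "N \<ge> 1 \<Longrightarrow> 0 \<le> arrival N (map_pmf (scaled N) q) a"
  by (cases a) (auto simp: departure_nonneg)

lemma arrival_le: "N \<ge> 1 \<Longrightarrow> arrival N (map_pmf (scaled N) q) a \<le> 20"
  using departure_le[of N q] departure_nonneg[of N q]
  by (cases a) (auto intro: order_trans[OF add_mono[of _ 10 _ 10]] order_trans[of _ 10])

text \<open>Each departure rate is the expectation of a function bounded by 10, and at most two of
  them enter an arrival rate.\<close>

lemma arrival_diff_le: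
  assumes "N \<ge> 1"
  shows "\<bar>arrival N (map_pmf (scaled N) p) a - arrival N (map_pmf (scaled N) q) a\<bar> \<le> 20 * l1_dist p q"
proof -
  have d: "\<bar>departure N (map_pmf (scaled N) p) b - departure N (map_pmf (scaled N) q) b\<bar>
      \<le> 10 * l1_dist p q" for b
    unfolding departure_map_scaled[OF assms]
    by (rule expectation_diff_le_l1_dist[OF abs_service_le])
  show ?thesis
    using d[of cO, unfolded abs_le_iff] d[of cA, unfolded abs_le_iff] d[of cB, unfolded abs_le_iff]
      d[of cAB, unfolded abs_le_iff] d[of cBA, unfolded abs_le_iff] l1_dist_nonneg[of p q]
    unfolding abs_le_iff by (cases a; simp only: arrival.simps; linarith)
qed

text \<open>An injective shift only relabels lattice points, so the shifted terms of the drift cost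
  no more than the unshifted ones.\<close>

lemma sum_shift_le_l1_dist:
  assumes "finite F" "inj_on f G" "G \<subseteq> F"
  shows "(\<Sum>n\<in>G. \<bar>pmf p (f n) - pmf q (f n)\<bar>) \<le> l1_dist p q"
proof -
  have "(\<Sum>n\<in>G. \<bar>pmf p (f n) - pmf q (f n)\<bar>) = (\<Sum>n\<in>f ` G. \<bar>pmf p n - pmf q n\<bar>)"
    using assms by (simp add: sum.reindex)
  also have "\<dots> \<le> l1_dist p q"
    using assms finite_subset by (intro sum_le_l1_dist) auto
  finally show ?thesis .
qed

lemma sum_pmf_le_1: "finite F \<Longrightarrow> (\<Sum>n\<in>F. pmf p n) \<le> 1"
  by (metis measure_measure_pmf_finite measure_pmf.prob_le_1)

lemma inj_incr: "inj_on (\<lambda>n::cls \<Rightarrow> nat. n(a := n a + 1)) A"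
  by (rule inj_onI) (metis Suc_eq_plus1 Suc_inject fun_upd_eqD fun_upd_triv fun_upd_upd)

lemma inj_decr: "inj_on (\<lambda>n::cls \<Rightarrow> nat. n(a := n a - 1)) {n\<in>F. n a \<noteq> 0}"
proof (rule inj_onI)
  fix m n :: "cls \<Rightarrow> nat"
  assume mn: "m \<in> {n\<in>F. n a \<noteq> 0}" "n \<in> {n\<in>F. n a \<noteq> 0}"
    and eq: "m(a := m a - 1) = n(a := n a - 1)"
  have "m b = n b" for b
    using fun_cong[OF eq, of b] mn by (cases "b = a") auto
  then show "m = n" by auto
qed

text \<open>The split is \<open>s * (x - y) + (s - t) * y\<close>. In its use for the drift, the
  difference of the rates is thus weighted by a mass of the second measure, and these masses sum to
  at most 1.\<close>

lemma prod_diff_bound: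
  fixes x y s t :: real
  assumes "\<bar>s\<bar> \<le> B" "0 \<le> y" "\<bar>s - t\<bar> \<le> e"
  shows "\<bar>x * s - y * t\<bar> \<le> B * \<bar>x - y\<bar> + e * y"
proof -
  have "x * s - y * t = s * (x - y) + (s - t) * y" by (simp add: algebra_simps)
  also have "\<bar>\<dots>\<bar> \<le> \<bar>s\<bar> * \<bar>x - y\<bar> + \<bar>s - t\<bar> * y"
    using assms by (simp add: abs_mult abs_triangle_ineq[THEN order_trans])
  also have "\<dots> \<le> B * \<bar>x - y\<bar> + e * y"
    using assms by (intro add_mono mult_right_mono) auto
  finally show ?thesis .
qed

text \<open>The constant collects 150 + 100 from the outflow, 5 * (20 + 20) from the arrivals and 5
  * 10 from the services. It is independent of \<open>F\<close>, so \<open>F\<close> can be enlarged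
  freely later on.\<close>

lemma drift_lipschitz:
  assumes N: "N \<ge> 1" and F: "finite F"
  shows "(\<Sum>n\<in>F. \<bar>drift N (map_pmf (scaled N) p) n - drift N (map_pmf (scaled N) q) n\<bar>)
    \<le> 500 * l1_dist p q"
proof -
  let ?P = "map_pmf (scaled N) p" and ?Q = "map_pmf (scaled N) q" and ?d = "l1_dist p q"
  have m: "mass N ?P = pmf p" "mass N ?Q = pmf q" by (auto simp: mass_map_scaled[OF N])
  have A: "0 \<le> arrival N ?P a" "arrival N ?P a \<le> 20" for a
    by (simp_all only: arrival_nonneg[OF N] arrival_le[OF N])
  define s where "s r n = (\<Sum>a\<in>UNIV. arrival N r a + service a n)" for r n
  define g where "g n = \<bar>pmf p n - pmf q n\<bar>" for n
  define dn where "dn a n = n(a := n a - 1)" for a :: cls and n :: "cls \<Rightarrow> nat"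
  define up where "up a n = n(a := n a + 1)" for a :: cls and n :: "cls \<Rightarrow> nat"
  let ?G = "\<lambda>a. {n\<in>F. n a \<noteq> 0}"
  have 1: "\<bar>pmf p n * s ?P n - pmf q n * s ?Q n\<bar> \<le> 150 * g n + 100 * ?d * pmf q n" for n
    unfolding g_def
  proof (rule prod_diff_bound)
    \<comment> \<open>Five classes, each with arrival rate at most 20 and service rate at most
      10.\<close>
    have "\<bar>s ?P n\<bar> \<le> (\<Sum>a\<in>(UNIV :: cls set). 30)"
      unfolding s_def using A
      by (intro order_trans[OF sum_abs] sum_mono)
        (smt (verit) service_nonneg service_le)
    then show "\<bar>s ?P n\<bar> \<le> 150" by (simp add: card_cls)
    have "\<bar>s ?P n - s ?Q n\<bar> \<le> (\<Sum>a\<in>(UNIV :: cls set). 20 * ?d)"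
      unfolding s_def sum_subtractf[symmetric]
      by (intro order_trans[OF sum_abs] sum_mono) (simp add: arrival_diff_le[OF N])
    then show "\<bar>s ?P n - s ?Q n\<bar> \<le> 100 * ?d" by (simp add: card_cls)
  qed simp
  have 2: "\<bar>pmf p n * arrival N ?P a - pmf q n * arrival N ?Q a\<bar> \<le> 20 * g n + 20 * ?d * pmf q n" for n a
    unfolding g_def using A[of a] by (intro prod_diff_bound arrival_diff_le[OF N]) auto
  \<comment> \<open>The service rate is the same for both measures, so the error term with
    \<open>e\<close> is 0.\<close>
  have 3: "\<bar>pmf p n * service a n - pmf q n * service a n\<bar> \<le> 10 * g n" for n a
    using prod_diff_bound[OF abs_service_le, of "pmf q n" a n "service a n" 0 "pmf p n"]
    by (simp add: g_def)
  have if2: "\<bar>if n a \<noteq> 0 then pmf p (dn a n) * arrival N ?P a - pmf q (dn a n) * arrival N ?Q a else 0\<bar>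
      \<le> (if n a \<noteq> 0 then 20 * g (dn a n) + 20 * ?d * pmf q (dn a n) else 0)" for n a
    using 2[of "dn a n" a] by (cases "n a = 0") simp_all
  have tri: "\<bar>- x + y + z\<bar> \<le> \<bar>x\<bar> + \<bar>y\<bar> + \<bar>z\<bar>" for x y z :: real
    by linarith
  have bd: "\<bar>drift N ?P n - drift N ?Q n\<bar> \<le> (150 * g n + 100 * ?d * pmf q n)
      + (\<Sum>a\<in>UNIV. if n a \<noteq> 0 then 20 * g (dn a n) + 20 * ?d * pmf q (dn a n) else 0)
      + (\<Sum>a\<in>UNIV. 10 * g (up a n))" for n
  proof -
    have e: "drift N ?P n - drift N ?Q n = - (pmf p n * s ?P n - pmf q n * s ?Q n)
      + (\<Sum>a\<in>UNIV. if n a \<noteq> 0 then pmf p (dn a n) * arrival N ?P a - pmf q (dn a n) * arrival N ?Q a else 0)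
      + (\<Sum>a\<in>UNIV. pmf p (up a n) * service a (up a n) - pmf q (up a n) * service a (up a n))"
      unfolding drift_def m s_def dn_def up_def sum_subtractf
      by (simp add: sum_UNIV_cls)
    have "\<bar>drift N ?P n - drift N ?Q n\<bar> \<le> \<bar>pmf p n * s ?P n - pmf q n * s ?Q n\<bar>
      + \<bar>\<Sum>a\<in>UNIV. if n a \<noteq> 0 then pmf p (dn a n) * arrival N ?P a - pmf q (dn a n) * arrival N ?Q a else 0\<bar>
      + \<bar>\<Sum>a\<in>UNIV. pmf p (up a n) * service a (up a n) - pmf q (up a n) * service a (up a n)\<bar>"
      unfolding e by (rule tri)
    also have "\<dots> \<le> (150 * g n + 100 * ?d * pmf q n)
      + (\<Sum>a\<in>UNIV. if n a \<noteq> 0 then 20 * g (dn a n) + 20 * ?d * pmf q (dn a n) else 0)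
      + (\<Sum>a\<in>UNIV. 10 * g (up a n))"
      by (rule add_mono[OF add_mono]; (rule order_trans[OF sum_abs], rule sum_mono)?) (rule 1 if2 3)+
    finally show ?thesis .
  qed
  have g1: "sum g F \<le> ?d" unfolding g_def using F by (rule sum_le_l1_dist)
  have q1: "sum (pmf q) F \<le> 1" using F by (rule sum_pmf_le_1)
  have g2: "(\<Sum>n\<in>?G a. g (dn a n)) \<le> ?d" for a
    unfolding g_def dn_def by (intro sum_shift_le_l1_dist[OF F inj_decr]) auto
  have q2: "(\<Sum>n\<in>?G a. pmf q (dn a n)) \<le> 1" for a
    using sum_pmf_le_1[of "dn a ` ?G a" q] F inj_decr[of a F]
    unfolding dn_def by (simp add: sum.reindex)
  have g3: "(\<Sum>n\<in>F. g (up a n)) \<le> ?d" for a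
    unfolding g_def up_def by (intro sum_shift_le_l1_dist[OF F inj_incr]) auto
  have "(\<Sum>n\<in>F. \<bar>drift N ?P n - drift N ?Q n\<bar>) \<le> (\<Sum>n\<in>F. (150 * g n + 100 * ?d * pmf q n)
      + (\<Sum>a\<in>UNIV. if n a \<noteq> 0 then 20 * g (dn a n) + 20 * ?d * pmf q (dn a n) else 0)
      + (\<Sum>a\<in>UNIV. 10 * g (up a n)))"
    by (intro sum_mono bd)
  also have "\<dots> = (150 * sum g F + 100 * ?d * sum (pmf q) F)
      + (\<Sum>a\<in>UNIV. 20 * (\<Sum>n\<in>?G a. g (dn a n)) + 20 * ?d * (\<Sum>n\<in>?G a. pmf q (dn a n)))
      + (\<Sum>a\<in>UNIV. 10 * (\<Sum>n\<in>F. g (up a n)))"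
  proof -
    have "(\<Sum>n\<in>F. \<Sum>a\<in>UNIV. if n a \<noteq> 0 then 20 * g (dn a n) + 20 * ?d * pmf q (dn a n) else 0)
        = (\<Sum>a\<in>UNIV. \<Sum>n\<in>?G a. 20 * g (dn a n) + 20 * ?d * pmf q (dn a n))"
      by (subst sum.swap) (simp add: sum.inter_filter[OF F])
    moreover have "(\<Sum>n\<in>F. \<Sum>a\<in>UNIV. 10 * g (up a n)) = (\<Sum>a\<in>UNIV. \<Sum>n\<in>F. 10 * g (up a n))"
      by (rule sum.swap)
    ultimately show ?thesis
      by (simp only: sum.distrib sum_distrib_left)
  qed
  also have "\<dots> \<le> (150 * ?d + 100 * ?d * 1)
      + (\<Sum>a\<in>(UNIV :: cls set). 20 * ?d + 20 * ?d * 1) + (\<Sum>a\<in>(UNIV :: cls set). 10 * ?d)"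
    using l1_dist_nonneg[of p q]
    by (intro add_mono sum_mono mult_left_mono g1 g2 g3 q1 q2) auto
  also have "\<dots> = 500 * ?d" by (simp add: card_cls)
  finally show ?thesis .
qed


section \<open>The generator of the network on functions of the configuration\<close>

text \<open>Sums over moves instead of target configurations: moves with a common target add up in
  \<open>jump_rate\<close>, and a move that changes nothing contributes 0.\<close>

definition gen :: "nat \<Rightarrow> (config \<Rightarrow> real) \<Rightarrow> config \<Rightarrow> real" where
  "gen M h k = (\<Sum>i<M. \<Sum>a\<in>UNIV. \<Sum>j<M. \<Sum>b\<in>UNIV.
     service a (k i) * route a b / real M * (h (move i a j b k) - h k))"

lemma finite_configs: "finite (configs N M)"
proof -
  let ?B = "{f :: cls \<Rightarrow> nat. \<forall>a. (a \<in> UNIV \<longrightarrow> f a \<in> {..N * M}) \<and> (a \<notin> UNIV \<longrightarrow> f a = 0)}"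
  have fB: "finite ?B"
    by (intro finite_set_of_finite_funs) auto
  have "k i a \<le> N * M" if "k \<in> configs N M" "i < M" for k i a
  proof -
    have "k i a \<le> (\<Sum>a\<in>UNIV. k i a)"
      by (intro member_le_sum) auto
    also have "\<dots> \<le> (\<Sum>i<M. \<Sum>a\<in>UNIV. k i a)"
      using that by (intro member_le_sum[of i "{..<M}" "\<lambda>i. \<Sum>a\<in>UNIV. k i a"]) auto
    finally show ?thesis using that by (simp add: configs_def)
  qed
  then have "configs N M \<subseteq> {k. \<forall>i. (i \<in> {..<M} \<longrightarrow> k i \<in> ?B) \<and> (i \<notin> {..<M} \<longrightarrow> k i = (\<lambda>_. 0))}"
    by (auto simp: configs_def not_less)
  moreover have "finite {k. \<forall>i. (i \<in> {..<M} \<longrightarrow> k i \<in> ?B) \<and> (i \<notin> {..<M} \<longrightarrow> k i = (\<lambda>_. 0))}"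
    using fB by (intro finite_set_of_finite_funs) auto
  ultimately show ?thesis by (rule finite_subset)
qed

lemma sum_config_upd:
  fixes k :: config
  assumes "i < M"
  shows "(\<Sum>l<M. \<Sum>c\<in>UNIV. (k(i := (k i)(a := x))) l c) + k i a = (\<Sum>l<M. \<Sum>c\<in>UNIV. k l c) + x"
proof -
  have 1: "(\<Sum>c\<in>UNIV. ((k i)(a := x)) c) + k i a = (\<Sum>c\<in>UNIV. k i c) + x"
    by (subst (1 2) sum.remove[of UNIV a]) auto
  show ?thesis
    using assms 1 by (subst (1 2) sum.remove[of "{..<M}" i]) auto
qed

lemma move_in_configs:
  assumes k: "k \<in> configs N M" and "i < M" "j < M" "k i a > 0"
  shows "move i a j b k \<in> configs N M"
proof -
  define k' where "k' = k(i := (k i)(a := k i a - 1))"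
  have "(\<Sum>l<M. \<Sum>c\<in>UNIV. k' l c) + 1 = N * M"
    using sum_config_upd[OF \<open>i < M\<close>, of k a "k i a - 1"] assms
    by (simp add: k'_def configs_def)
  moreover have "(\<Sum>l<M. \<Sum>c\<in>UNIV. (k'(j := (k' j)(b := k' j b + 1))) l c) = (\<Sum>l<M. \<Sum>c\<in>UNIV. k' l c) + 1"
    using sum_config_upd[OF \<open>j < M\<close>, of k' b "k' j b + 1"] by simp
  ultimately show ?thesis
    using assms by (auto simp: configs_def move_def k'_def[symmetric] simp del: fun_upd_apply)
      (auto simp: k'_def)
qed

lemma sum_generator:
  assumes "finite S" "x \<in> S"
  shows "(\<Sum>y\<in>S. generator S q x y * h y) = (\<Sum>y\<in>S. q x y * (h y - h x))"
proof -
  have "(\<Sum>y\<in>S. generator S q x y * h y) = generator S q x x * h x + (\<Sum>y\<in>S-{x}. generator S q x y * h y)"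
    using assms by (simp add: sum.remove)
  also have "(\<Sum>y\<in>S-{x}. generator S q x y * h y) = (\<Sum>y\<in>S-{x}. q x y * h y)"
    by (intro sum.cong) (auto simp: generator_def)
  also have "generator S q x x * h x + \<dots> = (\<Sum>y\<in>S-{x}. q x y * (h y - h x))"
    by (simp add: generator_def right_diff_distrib sum_subtractf sum_distrib_right)
  also have "\<dots> = (\<Sum>y\<in>S. q x y * (h y - h x))"
    using assms by (simp add: sum.remove)
  finally show ?thesis .
qed

text \<open>A move of positive rate takes an existing customer and so stays in the state set. With
  no customer to take, truncated subtraction would make \<open>move\<close> create one and leave the
  set, but then the rate is 0.\<close>

lemma sum_generator_eq_gen:
  assumes k: "k \<in> configs N M"
  shows "(\<Sum>y\<in>configs N M. generator (configs N M) (jump_rate M) k y * h y) = gen M h k"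
proof -
  have *: "(\<Sum>y\<in>configs N M. (if y = move i a j b k then service a (k i) * route a b / real M else 0) * (h y - h k))
      = service a (k i) * route a b / real M * (h (move i a j b k) - h k)"
    if "i < M" "j < M" for i j a b
  proof (cases "service a (k i) = 0")
    case False
    then have "move i a j b k \<in> configs N M"
      using move_in_configs[OF k that] service_pos_imp by blast
    then show ?thesis
      by (simp add: if_distrib[of "\<lambda>x. x * _"] finite_configs cong: if_cong)
  qed (auto intro!: sum.neutral)
  have "(\<Sum>y\<in>configs N M. generator (configs N M) (jump_rate M) k y * h y)
      = (\<Sum>y\<in>configs N M. jump_rate M k y * (h y - h k))"
    by (rule sum_generator[OF finite_configs k])
  also have "\<dots> = (\<Sum>i<M. \<Sum>a\<in>UNIV. \<Sum>j<M. \<Sum>b\<in>UNIV. \<Sum>y\<in>configs N M.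
      (if y = move i a j b k then service a (k i) * route a b / real M else 0) * (h y - h k))"
    unfolding jump_rate_def sum_distrib_right
    by (simp only: sum.swap[of _ _ "configs N M"])
  also have "\<dots> = gen M h k"
    unfolding gen_def by (intro sum.cong refl) (rule *, auto)
  finally show ?thesis .
qed

lemma contents_move:
  assumes "a \<noteq> b"
  shows "contents (move i a j b k) \<iota> =
    (let c = contents k \<iota>; c' = (if node_index \<iota> a = i then c(a := c a - 1) else c)
     in if node_index \<iota> b = j then c'(b := c' b + 1) else c')"
  using assms by (auto simp: contents_def move_def Let_def fun_eq_iff)

text \<open>Each node of a given type lies in exactly \<open>M^2\<close> of the \<open>M^3\<close>
  triples.\<close>

lemma avg_node:
  assumes "M \<ge> 1"
  shows "(\<Sum>\<iota>\<in>triples M. f (node_index \<iota> a)) / real M ^ 3 = (\<Sum>i<M. f i) / real M"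
proof -
  have "(\<Sum>\<iota>\<in>triples M. f (node_index \<iota> a)) = real M ^ 2 * (\<Sum>i<M. f i)"
    by (cases a) (simp_all add: triples_def sum.cartesian_product' power2_eq_square
        flip: sum_distrib_left sum_distrib_right)
  then show ?thesis using assms by (simp add: power3_eq_cube power2_eq_square)
qed

lemma departure_empirical:
  assumes "N \<ge> 1" "M \<ge> 1"
  shows "departure N (empirical N M k) a = (\<Sum>i<M. service a (k i)) / real M"
  using avg_node[OF assms(2), of "\<lambda>i. service a (k i)" a]
  unfolding empirical_eq[OF assms(2)] departure_map_scaled[OF assms(1)]
    expectation_contents_pmf[OF assms(2)] avg_def service_contents by simp

lemma sum_rate:
  assumes "M \<ge> 1"
  shows "(\<Sum>j<M. \<Sum>b\<in>UNIV. x * route a b / real M) = x"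
proof -
  have "(\<Sum>j<M. \<Sum>b\<in>UNIV. x * route a b / real M) = (\<Sum>j<M. x / real M * (\<Sum>b\<in>UNIV. route a b))"
    by (simp add: sum_distrib_left)
  also have "\<dots> = x" using assms by (simp add: sum_route)
  finally show ?thesis .
qed

text \<open>For a fixed triple, the effect of a move is a departure effect if the source lies in the
  triple, plus an arrival effect if the destination does, plus a mixed difference if both do. The
  first two add up exactly to services at the present contents and arrivals at the mean-field rates.
  The mixed one selects a single pair of nodes for each routing, at rate at most
  \<open>10 / M * route a b\<close>, and has size at most 2 as \<open>g\<close> takes values in
  [0,1]; over the five classes \<open>a\<close> this gives \<open>100 / M\<close>.\<close>

lemma gen_avg:
  assumes N: "N \<ge> 1" and M: "M \<ge> 1" and g: "\<And>c. 0 \<le> g c" "\<And>c. g c \<le> (1 :: real)"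
  shows "\<bar>gen M (\<lambda>k. avg M k g) k -
      avg M k (\<lambda>c. (\<Sum>a\<in>UNIV. service a c * (g (c(a := c a - 1)) - g c))
        + (\<Sum>b\<in>UNIV. arrival N (empirical N M k) b * (g (c(b := c b + 1)) - g c)))\<bar> \<le> 100 / real M"
proof -
  define X where "X a c = g (c(a := c a - 1)) - g c" for a c
  define Y where "Y b c = g (c(b := c b + 1)) - g c" for b c
  define E where "E a b c = g (c(a := c a - 1, b := c b + 1)) - g (c(a := c a - 1)) - g (c(b := c b + 1)) + g c"
    for a b c
  define r where "r i a b = service a (k i) * route a b / real M" for i a b
  have split: "r i a b * (g (contents (move i a j b k) \<iota>) - g (contents k \<iota>)) =
      (if node_index \<iota> a = i then r i a b * X a (contents k \<iota>) else 0)
      + (if node_index \<iota> b = j then r i a b * Y b (contents k \<iota>) else 0)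
      + (if node_index \<iota> a = i \<and> node_index \<iota> b = j then r i a b * E a b (contents k \<iota>) else 0)"
    for i a j b \<iota>
  proof (cases "a = b")
    case True
    then have "route a b = 0" using route_neq by blast
    then show ?thesis by (simp add: r_def)
  next
    case False
    then show ?thesis
      by (simp add: contents_move Let_def X_def Y_def E_def algebra_simps)
  qed
  have S1: "(\<Sum>i<M. \<Sum>a\<in>UNIV. \<Sum>j<M. \<Sum>b\<in>UNIV.
      if node_index \<iota> a = i then r i a b * X a (contents k \<iota>) else 0)
      = (\<Sum>a\<in>UNIV. service a (contents k \<iota>) * X a (contents k \<iota>))" (is "?L = _")
    if \<iota>: "\<iota> \<in> triples M" for \<iota>
  proof -
    have "?L = (\<Sum>a\<in>UNIV. \<Sum>i<M. if node_index \<iota> a = i then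
        (\<Sum>j<M. \<Sum>b\<in>UNIV. (service a (k i) * X a (contents k \<iota>)) * route a b / real M) else 0)"
      by (subst sum.swap) (intro sum.cong refl, auto simp: r_def intro!: sum.cong)
    also have "\<dots> = (\<Sum>a\<in>UNIV. service a (k (node_index \<iota> a)) * X a (contents k \<iota>))"
      by (simp only: sum_rate[OF M]) (simp add: node_index_less[OF \<iota>])
    finally show ?thesis by (simp add: service_contents)
  qed
  have S2: "(\<Sum>i<M. \<Sum>a\<in>UNIV. \<Sum>j<M. \<Sum>b\<in>UNIV.
      if node_index \<iota> b = j then r i a b * Y b (contents k \<iota>) else 0)
      = (\<Sum>b\<in>UNIV. arrival N (empirical N M k) b * Y b (contents k \<iota>))" (is "?L = _")
    if \<iota>: "\<iota> \<in> triples M" for \<iota>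
  proof -
    \<comment> \<open>The triple fixes only the destination, so the sum over all sources remains;
      with the factor \<open>1 / M\<close> in \<open>r\<close> it is the arrival rate of the
      empirical measure.\<close>
    have "?L = (\<Sum>i<M. \<Sum>a\<in>UNIV. \<Sum>b\<in>UNIV. r i a b * Y b (contents k \<iota>))"
      by (subst sum.swap[of _ UNIV "{..<M}"]) (simp add: node_index_less[OF \<iota>])
    also have "\<dots> = (\<Sum>b\<in>UNIV. \<Sum>a\<in>UNIV. \<Sum>i<M. r i a b * Y b (contents k \<iota>))"
      by (subst sum.swap, subst sum.swap[of _ UNIV "{..<M}"], subst sum.swap) (rule refl)
    also have "\<dots> = (\<Sum>b\<in>UNIV. arrival N (empirical N M k) b * Y b (contents k \<iota>))"
      unfolding arrival_eq departure_empirical[OF N M] r_def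
      by (simp add: sum_distrib_right sum_divide_distrib)
    finally show ?thesis .
  qed
  have S3: "\<bar>\<Sum>i<M. \<Sum>a\<in>UNIV. \<Sum>j<M. \<Sum>b\<in>UNIV.
      if node_index \<iota> a = i \<and> node_index \<iota> b = j then r i a b * E a b (contents k \<iota>) else 0\<bar>
      \<le> 100 / real M" (is "\<bar>?L\<bar> \<le> _")
    if \<iota>: "\<iota> \<in> triples M" for \<iota>
  proof -
    have "?L = (\<Sum>i<M. \<Sum>a\<in>UNIV. \<Sum>b\<in>UNIV. if node_index \<iota> a = i then r i a b * E a b (contents k \<iota>) else 0)"
      by (subst sum.swap[of _ UNIV "{..<M}"])
        (intro sum.cong refl, auto simp: node_index_less[OF \<iota>])
    also have "\<dots> = (\<Sum>a\<in>UNIV. \<Sum>b\<in>UNIV. r (node_index \<iota> a) a b * E a b (contents k \<iota>))"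
      by (subst sum.swap, intro sum.cong refl, subst sum.swap) (simp add: node_index_less[OF \<iota>])
    also have "\<bar>\<dots>\<bar> \<le> (\<Sum>a\<in>UNIV. \<Sum>b\<in>UNIV. \<bar>r (node_index \<iota> a) a b * E a b (contents k \<iota>)\<bar>)"
      by (intro order_trans[OF sum_abs] sum_mono) auto
    also have "\<dots> \<le> (\<Sum>a\<in>UNIV. \<Sum>b\<in>UNIV. 20 / real M * route a b)"
    proof (intro sum_mono)
      fix a b
      have "\<bar>E a b (contents k \<iota>)\<bar> \<le> 2"
        unfolding E_def abs_le_iff using g by (smt (verit))
      moreover have "\<bar>r (node_index \<iota> a) a b\<bar> \<le> 10 / real M * route a b"
        using M service_le[of a] service_nonneg[of a] route_nonneg[of a b]
        by (simp add: r_def abs_mult divide_simps mult_right_mono)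
      ultimately have "\<bar>r (node_index \<iota> a) a b\<bar> * \<bar>E a b (contents k \<iota>)\<bar> \<le> (10 / real M * route a b) * 2"
        by (intro mult_mono) (auto simp: route_nonneg)
      then show "\<bar>r (node_index \<iota> a) a b * E a b (contents k \<iota>)\<bar> \<le> 20 / real M * route a b"
        by (simp add: abs_mult)
    qed
    also have "\<dots> = (\<Sum>a\<in>UNIV. 20 / real M * (\<Sum>b\<in>UNIV. route a b))"
      by (simp only: sum_distrib_left)
    also have "\<dots> = 100 / real M"
      by (simp add: sum_route card_cls)
    finally show ?thesis .
  qed
  define W where "W \<iota> = (\<Sum>i<M. \<Sum>a\<in>UNIV. \<Sum>j<M. \<Sum>b\<in>UNIV.
      r i a b * (g (contents (move i a j b k) \<iota>) - g (contents k \<iota>)))" for \<iota>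
  define Z where "Z c = (\<Sum>a\<in>UNIV. service a c * X a c)
      + (\<Sum>b\<in>UNIV. arrival N (empirical N M k) b * Y b c)" for c
  have WZ: "\<bar>W \<iota> - Z (contents k \<iota>)\<bar> \<le> 100 / real M" if "\<iota> \<in> triples M" for \<iota>
    unfolding W_def Z_def split sum.distrib S1[OF that] S2[OF that]
    using S3[OF that] by simp
  have "gen M (\<lambda>k. avg M k g) k = (\<Sum>i<M. \<Sum>a\<in>UNIV. \<Sum>j<M. \<Sum>b\<in>UNIV. \<Sum>\<iota>\<in>triples M.
      r i a b * (g (contents (move i a j b k) \<iota>) - g (contents k \<iota>))) / real M ^ 3"
    unfolding gen_def avg_def r_def
    by (simp add: sum_distrib_left sum_divide_distrib sum_subtractf right_diff_distrib diff_divide_distrib)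
  also have "\<dots> = (\<Sum>\<iota>\<in>triples M. W \<iota>) / real M ^ 3"
    unfolding W_def by (simp only: sum.swap[of _ _ "triples M"])
  finally have "gen M (\<lambda>k. avg M k g) k - avg M k Z = (\<Sum>\<iota>\<in>triples M. W \<iota> - Z (contents k \<iota>)) / real M ^ 3"
    by (simp add: avg_def sum_subtractf diff_divide_distrib)
  also have "\<bar>\<dots>\<bar> \<le> (\<Sum>\<iota>\<in>triples M. 100 / real M) / real M ^ 3"
    unfolding abs_divide by (intro divide_mono order_trans[OF sum_abs] sum_mono WZ) (use M in auto)
  also have "\<dots> = 100 / real M"
    using M by (simp add: card_triples)
  finally show ?thesis unfolding Z_def X_def Y_def .
qed

text \<open>Duality of the forward equation: shifting the indicator of \<open>n\<close> by one
  customer picks out a neighbouring lattice point, and averages of indicators are masses.\<close>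

lemma drift_empirical:
  assumes N: "N \<ge> 1" and M: "M \<ge> 1"
  shows "drift N (empirical N M k) n =
    avg M k (\<lambda>c. (\<Sum>a\<in>UNIV. service a c * (indicator {n} (c(a := c a - 1)) - indicator {n} c))
      + (\<Sum>b\<in>UNIV. arrival N (empirical N M k) b * (indicator {n} (c(b := c b + 1)) - indicator {n} c)))"
proof -
  let ?p = "pmf (contents_pmf M k)" and ?r = "arrival N (empirical N M k)"
  have mass: "mass N (empirical N M k) = ?p"
    unfolding empirical_eq[OF M] by (simp add: fun_eq_iff mass_map_scaled[OF N])
  have p: "avg M k (\<lambda>c. x * indicator {m} c) = x * ?p m" for x m
    by (simp add: avg_cmult pmf_contents_pmf[OF M])
  \<comment> \<open>The exceptional case is \<open>c a = 0\<close>: truncated subtraction leaves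
    \<open>c\<close> unchanged, so the left indicator can be 1 although \<open>c\<close> is not the
    upper neighbour of \<open>n\<close>. There the service rate vanishes.\<close>
  have 1: "service a c * indicator {n} (c(a := c a - 1)) =
      service a (n(a := n a + 1)) * indicator {n(a := n a + 1)} c" for a c
  proof (cases "c = n(a := n a + 1)")
    case False
    have "service a c = 0" if "n = c(a := c a - 1)"
      using False that service_pos_imp[of a c] by (cases "c a") auto
    with False show ?thesis by (auto simp: indicator_def)
  qed (auto simp: indicator_def)
  \<comment> \<open>An arrival never produces a coordinate 0; this matches the boundary convention
    in \<open>drift\<close>.\<close>
  have 2: "indicator {n} (c(b := c b + 1)) =
      (if n b = 0 then 0 else (indicator {n(b := n b - 1)} c :: real))" for b c
    by (cases "n b") (auto simp: indicator_def)
  have 3: "service a c * indicator {n} c = service a n * indicator {n} c" for a c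
    by (auto simp: indicator_def)
  have "avg M k (\<lambda>c. (\<Sum>a\<in>UNIV. service a c * (indicator {n} (c(a := c a - 1)) - indicator {n} c))
      + (\<Sum>b\<in>UNIV. ?r b * (indicator {n} (c(b := c b + 1)) - indicator {n} c)))
    = (\<Sum>a\<in>UNIV. avg M k (\<lambda>c. service a (n(a := n a + 1)) * indicator {n(a := n a + 1)} c)
        - avg M k (\<lambda>c. service a n * indicator {n} c))
      + (\<Sum>b\<in>UNIV. avg M k (\<lambda>c. if n b = 0 then 0 else ?r b * indicator {n(b := n b - 1)} c)
        - avg M k (\<lambda>c. ?r b * indicator {n} c))"
    unfolding avg_add avg_sum right_diff_distrib avg_diff 1 2 3
    by (intro arg_cong2[of _ _ _ _ "(+)"] arg_cong2[of _ _ _ _ "(-)"] sum.cong refl arg_cong[of _ _ "avg M k"])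
      auto
  also have "\<dots> = (\<Sum>a\<in>UNIV. service a (n(a := n a + 1)) * ?p (n(a := n a + 1)) - service a n * ?p n)
      + (\<Sum>b\<in>UNIV. (if n b = 0 then 0 else ?r b * ?p (n(b := n b - 1))) - ?r b * ?p n)"
  proof -
    have "avg M k (\<lambda>c. if n b = 0 then 0 else ?r b * indicator {n(b := n b - 1)} c)
        = (if n b = 0 then 0 else ?r b * ?p (n(b := n b - 1)))" for b
      using p by (simp add: avg_def)
    then show ?thesis by (simp only: p)
  qed
  also have "\<dots> = drift N (empirical N M k) n"
  proof -
    define T where "T b = (if n b = 0 then 0 else ?p (n(b := n b - 1)) * ?r b)" for b
    have T: "(if n b = 0 then 0 else ?r b * ?p (n(b := n b - 1))) = T b" for b
      by (simp add: T_def)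
    show ?thesis
      unfolding drift_def mass T T_def[symmetric]
      by (simp add: sum.distrib sum_subtractf sum_negf distrib_left sum_distrib_left mult.commute)
  qed
  finally show ?thesis ..
qed

lemma gen_pmf_contents:
  assumes N: "N \<ge> 1" and M: "M \<ge> 1"
  shows "\<bar>gen M (\<lambda>k. pmf (contents_pmf M k) n) k - drift N (empirical N M k) n\<bar> \<le> 100 / real M"
  unfolding drift_empirical[OF N M] pmf_contents_pmf[OF M]
  by (rule gen_avg[OF N M]) (auto simp: indicator_def)

text \<open>The source and the destination each lie in a fraction \<open>1 / M\<close> of the
  triples, and only there can the indicator change.\<close>

lemma pmf_contents_move:
  assumes M: "M \<ge> 1" and ab: "a \<noteq> b" and ij: "i < M" "j < M"
  shows "\<bar>pmf (contents_pmf M (move i a j b k)) n - pmf (contents_pmf M k) n\<bar> \<le> 2 / real M"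
proof -
  let ?g = "indicator {n} :: _ \<Rightarrow> real"
  let ?I = "\<lambda>i j. if i = j then 1 else 0 :: real"
  have 1: "\<bar>?g (contents (move i a j b k) \<iota>) - ?g (contents k \<iota>)\<bar> \<le> ?I i (node_index \<iota> a) + ?I j (node_index \<iota> b)"
    for \<iota>
    by (auto simp: contents_move[OF ab] indicator_def)
  have "\<bar>avg M (move i a j b k) ?g - avg M k ?g\<bar>
      = \<bar>\<Sum>\<iota>\<in>triples M. ?g (contents (move i a j b k) \<iota>) - ?g (contents k \<iota>)\<bar> / real M ^ 3"
    by (simp add: avg_def sum_subtractf flip: diff_divide_distrib)
  also have "\<dots> \<le> (\<Sum>\<iota>\<in>triples M. ?I i (node_index \<iota> a) + ?I j (node_index \<iota> b)) / real M ^ 3"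
    by (intro divide_right_mono order_trans[OF sum_abs] sum_mono 1) auto
  also have "\<dots> = (\<Sum>x<M. ?I i x) / real M + (\<Sum>x<M. ?I j x) / real M"
    using avg_node[OF M, of "?I i" a] avg_node[OF M, of "?I j" b]
    by (simp only: sum.distrib add_divide_distrib)
  also have "\<dots> = 2 / real M" using ij by simp
  finally show ?thesis by (simp add: pmf_contents_pmf[OF M])
qed

section \<open>Smoothing the absolute value\<close>

text \<open>
  The smoothed absolute value \<open>\<lambda>x. sqrt (\<delta>\<^sup>2 + x\<^sup>2)\<close> has derivative bounded by \<open>1\<close> and second
  derivative bounded by \<open>1 / \<delta>\<close>.
\<close>

lemma sqrt_second_order:
  assumes "\<delta> > 0"
  shows "sqrt (\<delta>\<^sup>2 + (x + h)\<^sup>2) \<le> sqrt (\<delta>\<^sup>2 + x\<^sup>2) + x / sqrt (\<delta>\<^sup>2 + x\<^sup>2) * h + h\<^sup>2 / \<delta>"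
proof -
  define s where "s = sqrt (\<delta>\<^sup>2 + x\<^sup>2)"
  define t where "t = sqrt (\<delta>\<^sup>2 + (x + h)\<^sup>2)"
  have s: "s > 0" "s\<^sup>2 = \<delta>\<^sup>2 + x\<^sup>2" "\<delta> \<le> s"
    using assms by (auto simp: s_def add_pos_nonneg real_le_rsqrt)
  have t: "t \<ge> 0" "t\<^sup>2 = \<delta>\<^sup>2 + (x + h)\<^sup>2"
    by (auto simp: t_def)
  \<comment> \<open>The arithmetic-geometric inequality replaces a Taylor expansion: dividing by
    \<open>2 * s\<close> yields the tangent plus the remainder \<open>h^2 / (2 * s)\<close>, and
    \<open>s\<close> is at least \<delta>.\<close>
  have "2 * s * t \<le> s\<^sup>2 + t\<^sup>2" by (rule sum_squares_bound)
  also have "\<dots> = 2 * s\<^sup>2 + 2 * x * h + h\<^sup>2"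
    unfolding s t by (simp add: power2_eq_square algebra_simps)
  finally have "t \<le> (2 * s\<^sup>2 + 2 * x * h + h\<^sup>2) / (2 * s)"
    using s by (simp add: pos_le_divide_eq mult.commute)
  also have "\<dots> = s + x / s * h + h\<^sup>2 / (2 * s)"
    using s by (simp add: field_simps power2_eq_square)
  also have "h\<^sup>2 / (2 * s) \<le> h\<^sup>2 / \<delta>"
    using s assms by (intro divide_left_mono) auto
  finally show ?thesis by (simp add: s_def t_def)
qed

text \<open>The remainder is the quadratic variation: the service rates total at most
  \<open>5 * 10 * M\<close>, and each jump contributes at most
  \<open>(2 / M)^2 / \<delta>\<close>.\<close>

lemma gen_sqrt:
  fixes n :: "cls \<Rightarrow> nat"
  assumes N: "N \<ge> 1" and M: "M \<ge> 1" and \<delta>: "\<delta> > 0"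
  defines "u \<equiv> \<lambda>k. pmf (contents_pmf M k) n"
  shows "gen M (\<lambda>k. sqrt (\<delta>\<^sup>2 + (u k - v)\<^sup>2)) k
    \<le> (u k - v) / sqrt (\<delta>\<^sup>2 + (u k - v)\<^sup>2) * gen M u k + 200 / (\<delta> * real M)"
proof -
  define D where "D = (u k - v) / sqrt (\<delta>\<^sup>2 + (u k - v)\<^sup>2)"
  define e where "e = (2 / real M)\<^sup>2 / \<delta>"
  have e: "e \<ge> 0" using \<delta> by (simp add: e_def)
  have 1: "service a (k i) * route a b / real M *
      (sqrt (\<delta>\<^sup>2 + (u (move i a j b k) - v)\<^sup>2) - sqrt (\<delta>\<^sup>2 + (u k - v)\<^sup>2))
    \<le> D * (service a (k i) * route a b / real M * (u (move i a j b k) - u k))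
      + (10 * e) * route a b / real M" if "i < M" "j < M" for i a j b
  proof (cases "a = b")
    case True
    then have "route a b = 0" using route_neq by blast
    then show ?thesis by simp
  next
    case False
    define h where "h = u (move i a j b k) - u k"
    have "\<bar>h\<bar> \<le> 2 / real M"
      unfolding h_def u_def by (rule pmf_contents_move[OF M False that])
    then have "h\<^sup>2 \<le> (2 / real M)\<^sup>2" by (rule power2_le_iff_abs_le[THEN iffD2, rotated]) simp
    then have "h\<^sup>2 / \<delta> \<le> e" unfolding e_def using \<delta> by (intro divide_right_mono) auto
    then have "sqrt (\<delta>\<^sup>2 + (u (move i a j b k) - v)\<^sup>2) - sqrt (\<delta>\<^sup>2 + (u k - v)\<^sup>2) \<le> D * h + e"
      using sqrt_second_order[OF \<delta>, of "u k - v" h] by (simp add: D_def h_def)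
    then have "service a (k i) * route a b / real M *
      (sqrt (\<delta>\<^sup>2 + (u (move i a j b k) - v)\<^sup>2) - sqrt (\<delta>\<^sup>2 + (u k - v)\<^sup>2))
      \<le> service a (k i) * route a b / real M * (D * h + e)"
      by (intro mult_left_mono) (auto simp: service_nonneg route_nonneg)
    also have "\<dots> = D * (service a (k i) * route a b / real M * h) + service a (k i) * (e * route a b / real M)"
      by (simp add: algebra_simps add_divide_distrib)
    also have "service a (k i) * (e * route a b / real M) \<le> 10 * (e * route a b / real M)"
      using e by (intro mult_right_mono service_le) (auto simp: route_nonneg)
    finally show ?thesis by (simp add: h_def)
  qed
  have "gen M (\<lambda>k. sqrt (\<delta>\<^sup>2 + (u k - v)\<^sup>2)) k \<le> (\<Sum>i<M. \<Sum>a\<in>UNIV. \<Sum>j<M. \<Sum>b\<in>UNIV.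
      D * (service a (k i) * route a b / real M * (u (move i a j b k) - u k)) + (10 * e) * route a b / real M)"
    unfolding gen_def by (intro sum_mono 1) auto
  also have "\<dots> = D * gen M u k + (\<Sum>i<M. \<Sum>a\<in>(UNIV :: cls set). 10 * e)"
    unfolding sum.distrib gen_def sum_distrib_left sum_rate[OF M] ..
  also have "(\<Sum>i<M. \<Sum>a\<in>(UNIV :: cls set). 10 * e) = 200 / (\<delta> * real M)"
    using M \<delta> by (simp add: card_cls e_def power2_eq_square field_simps)
  finally show ?thesis by (simp add: D_def)
qed


section \<open>One-time laws of a finite Markov chain and the forward equation\<close>

definition occupation :: "'w measure \<Rightarrow> (real \<Rightarrow> 'w \<Rightarrow> 's) \<Rightarrow> real \<Rightarrow> 's \<Rightarrow> real" where
  "occupation \<Omega> X t x = measure \<Omega> {\<omega>\<in>space \<Omega>. X t \<omega> = x}"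

lemma occupation_nonneg: "0 \<le> occupation \<Omega> X t x"
  by (simp add: occupation_def)

context
  fixes S :: "'s set" and q :: "'s \<Rightarrow> 's \<Rightarrow> real" and \<Omega> :: "'w measure" and X :: "real \<Rightarrow> 'w \<Rightarrow> 's"
  assumes mc: "markov_chain S q \<Omega> X" and fin: "finite S"
begin

interpretation prob_space \<Omega>
  using mc by (simp add: markov_chain_def)

lemma chain_measurable: "t \<ge> 0 \<Longrightarrow> X t \<in> measurable \<Omega> (count_space S)"
  using mc by (simp add: markov_chain_def)

lemma chain_in_states: "t \<ge> 0 \<Longrightarrow> \<omega> \<in> space \<Omega> \<Longrightarrow> X t \<omega> \<in> S"
  using measurable_space[OF chain_measurable] by simp

lemma chain_event: "t \<ge> 0 \<Longrightarrow> {\<omega>\<in>space \<Omega>. X t \<omega> = x} \<in> sets \<Omega>"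
proof -
  assume t: "t \<ge> 0"
  have "{\<omega>\<in>space \<Omega>. X t \<omega> = x} = X t -` ({x} \<inter> S) \<inter> space \<Omega>"
    using chain_in_states[OF t] by auto
  also have "\<dots> \<in> sets \<Omega>"
    using chain_measurable[OF t] by (rule measurable_sets) simp
  finally show ?thesis .
qed

lemma expectation_chain:
  assumes t: "t \<ge> 0"
  shows "(\<integral>\<omega>. h (X t \<omega>) \<partial>\<Omega>) = (\<Sum>x\<in>S. occupation \<Omega> X t x * h x :: real)"
proof -
  have "(\<integral>\<omega>. h (X t \<omega>) \<partial>\<Omega>)
      = (\<integral>\<omega>. (\<Sum>x\<in>S. h x * indicator {\<omega>\<in>space \<Omega>. X t \<omega> = x} \<omega>) \<partial>\<Omega>)"
  proof (intro Bochner_Integration.integral_cong refl)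
    fix \<omega> assume \<omega>: "\<omega> \<in> space \<Omega>"
    have "(\<Sum>x\<in>S. h x * indicator {\<omega>\<in>space \<Omega>. X t \<omega> = x} \<omega>) = (\<Sum>x\<in>S. if x = X t \<omega> then h x else 0)"
      using \<omega> by (intro sum.cong) (auto simp: indicator_def)
    also have "\<dots> = h (X t \<omega>)"
      using fin chain_in_states[OF t \<omega>] by simp
    finally show "h (X t \<omega>) = (\<Sum>x\<in>S. h x * indicator {\<omega>\<in>space \<Omega>. X t \<omega> = x} \<omega>)" ..
  qed
  also have "\<dots> = (\<Sum>x\<in>S. h x * occupation \<Omega> X t x)"
    using chain_event[OF t]
    by (subst Bochner_Integration.integral_sum)
      (auto simp: occupation_def emeasure_eq_measure intro!: integrable_mult_right integrable_real_indicator)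
  finally show ?thesis by (simp add: mult.commute)
qed

lemma sum_occupation: "t \<ge> 0 \<Longrightarrow> (\<Sum>x\<in>S. occupation \<Omega> X t x) = 1"
  using expectation_chain[of t "\<lambda>_. 1"] prob_space by simp

lemma occupation_le_1: "occupation \<Omega> X t x \<le> 1"
  unfolding occupation_def by (rule prob_le_1)

lemma occupation_semigroup:
  obtains P where "transition_semigroup S q P"
    "\<And>t h y. t \<ge> 0 \<Longrightarrow> h \<ge> 0 \<Longrightarrow> y \<in> S \<Longrightarrow>
      occupation \<Omega> X (t + h) y = (\<Sum>x\<in>S. occupation \<Omega> X t x * P h x y)"
proof -
  from mc obtain P where P: "transition_semigroup S q P"
    and markov: "\<And>(n::nat) (ts::nat \<Rightarrow> real) xs h y.
       0 \<le> ts 0 \<and> (\<forall>i<n. ts i < ts (Suc i)) \<and> 0 \<le> h \<and> (\<forall>i\<le>n. xs i \<in> S) \<and> y \<in> S \<Longrightarrow>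
       measure \<Omega> {\<omega>\<in>space \<Omega>. (\<forall>i\<le>n. X (ts i) \<omega> = xs i) \<and> X (ts n + h) \<omega> = y} =
       measure \<Omega> {\<omega>\<in>space \<Omega>. \<forall>i\<le>n. X (ts i) \<omega> = xs i} * P h (xs n) y"
    unfolding markov_chain_def by blast
  have "occupation \<Omega> X (t + h) y = (\<Sum>x\<in>S. occupation \<Omega> X t x * P h x y)"
    if th: "t \<ge> 0" "h \<ge> 0" and y: "y \<in> S" for t h y
  proof -
    let ?A = "\<lambda>x. {\<omega>\<in>space \<Omega>. X t \<omega> = x \<and> X (t + h) \<omega> = y}"
    have A: "?A x \<in> sets \<Omega>" for x
    proof -
      have "?A x = {\<omega>\<in>space \<Omega>. X t \<omega> = x} \<inter> {\<omega>\<in>space \<Omega>. X (t + h) \<omega> = y}" by auto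
      also have "\<dots> \<in> sets \<Omega>" using th by (intro sets.Int chain_event) auto
      finally show ?thesis .
    qed
    have "occupation \<Omega> X (t + h) y = measure \<Omega> (\<Union>x\<in>S. ?A x)"
      unfolding occupation_def using chain_in_states th
      by (intro arg_cong[of _ _ "measure \<Omega>"]) auto
    also have "\<dots> = (\<Sum>x\<in>S. measure \<Omega> (?A x))"
      using A fin by (intro finite_measure_finite_Union) (auto simp: disjoint_family_on_def)
    also have "\<dots> = (\<Sum>x\<in>S. occupation \<Omega> X t x * P h x y)"
    proof (rule sum.cong)
      fix x assume "x \<in> S"
      \<comment> \<open>The Markov property with \<open>t\<close> as its only observation time, that
        is \<open>n = 0\<close>.\<close>
      then show "measure \<Omega> (?A x) = occupation \<Omega> X t x * P h x y"
        using markov[of "\<lambda>_. t" 0 h "\<lambda>_. x" y] th y by (simp add: occupation_def)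
    qed simp
    finally show ?thesis .
  qed
  with P that show ?thesis by blast
qed

text \<open>\<open>transition_semigroup\<close> provides derivatives at time 0 only. The right
  derivative follows by stepping forward from \<open>t\<close>. For the left one, \<open>t\<close>
  is reached from an earlier \<open>u\<close>, so the weights are the probabilities at
  \<open>u\<close> and their left continuity has to come first; it follows from the same one-step
  identity, as the weights are at most 1.\<close>

lemma occupation_has_derivative:
  assumes t: "t \<ge> 0" and y: "y \<in> S"
  shows "((\<lambda>u. occupation \<Omega> X u y) has_real_derivative
     (\<Sum>x\<in>S. occupation \<Omega> X t x * generator S q x y)) (at t within {0..})"
proof -
  let ?\<pi> = "occupation \<Omega> X"
  obtain P where P: "transition_semigroup S q P" and
    step: "\<And>t h y. t \<ge> 0 \<Longrightarrow> h \<ge> 0 \<Longrightarrow> y \<in> S \<Longrightarrow> ?\<pi> (t + h) y = (\<Sum>x\<in>S. ?\<pi> t x * P h x y)"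
    using occupation_semigroup by blast
  have P': "((\<lambda>h. P h x y) has_real_derivative generator S q x y) (at 0 within {0..})"
    if "x \<in> S" "y \<in> S" for x y
    using P that by (simp add: transition_semigroup_def)
  let ?Q = "\<lambda>u. (?\<pi> u y - ?\<pi> t y) / (u - t)" and ?D = "\<Sum>x\<in>S. ?\<pi> t x * generator S q x y"
  have right: "(?Q \<longlongrightarrow> ?D) (at t within {t..})"
  proof -
    have "((\<lambda>u. P (u - t) x y) has_real_derivative generator S q x y) (at t within {t..})" if "x \<in> S" for x
    proof -
      have im: "(\<lambda>u. u - t) ` {t..} = {0..}"
        by (auto simp: image_iff intro!: bexI[of _ "_ + t"])
      have "((\<lambda>h. P h x y) has_real_derivative generator S q x y)
          (at (t - t) within (\<lambda>u. u - t) ` {t..})"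
        unfolding im using P'[OF that y] by simp
      moreover have "((\<lambda>u. u - t) has_real_derivative 1) (at t within {t..})"
        by (auto intro!: derivative_eq_intros)
      ultimately have "((\<lambda>h. P h x y) \<circ> (\<lambda>u. u - t) has_real_derivative generator S q x y * 1) (at t within {t..})"
        by (rule DERIV_image_chain)
      then show ?thesis by (simp add: o_def)
    qed
    then have "((\<lambda>u. \<Sum>x\<in>S. ?\<pi> t x * P (u - t) x y) has_real_derivative ?D) (at t within {t..})"
      by (intro DERIV_sum DERIV_cmult) auto
    then have "((\<lambda>u. ?\<pi> u y) has_real_derivative ?D) (at t within {t..})"
      by (rule has_field_derivative_transform_within[of _ _ _ _ 1]) (use step[OF t, of "_ - t" y] y in auto)
    then show ?thesis by (simp add: has_field_derivative_iff)
  qed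
  have left: "(?Q \<longlongrightarrow> ?D) (at t within {0..t})"
  proof -
    have dP: "((\<lambda>u. P (t - u) x z) has_real_derivative - generator S q x z) (at t within {0..t})"
      if "x \<in> S" "z \<in> S" for x z
    proof -
      have "(\<lambda>u. t - u) ` {0..t} \<subseteq> {0..}" by auto
      then have "((\<lambda>h. P h x z) has_real_derivative generator S q x z)
          (at (t - t) within (\<lambda>u. t - u) ` {0..t})"
        using P'[OF that] has_field_derivative_subset by fastforce
      moreover have "((\<lambda>u. t - u) has_real_derivative - 1) (at t within {0..t})"
        by (auto intro!: derivative_eq_intros)
      ultimately have "((\<lambda>h. P h x z) \<circ> (\<lambda>u. t - u) has_real_derivative generator S q x z * - 1) (at t within {0..t})"
        by (rule DERIV_image_chain)
      then show ?thesis by (simp add: o_def)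
    qed
    have dist: "\<bar>?\<pi> u z - ?\<pi> t z\<bar> \<le> (\<Sum>x\<in>S. \<bar>P (t - u) x z - P 0 x z\<bar>)"
      if u: "u \<in> {0..t}" and z: "z \<in> S" for u z
    proof -
      have "?\<pi> u z - ?\<pi> t z = (\<Sum>x\<in>S. ?\<pi> u x * (P 0 x z - P (t - u) x z))"
        using step[of u 0 z] step[of u "t - u" z] u z
        by (simp add: sum_subtractf right_diff_distrib)
      also have "\<bar>\<dots>\<bar> \<le> (\<Sum>x\<in>S. \<bar>P (t - u) x z - P 0 x z\<bar>)"
        by (intro order_trans[OF sum_abs] sum_mono)
          (simp add: abs_mult abs_minus_commute mult_left_le_one_le occupation_nonneg occupation_le_1)
      finally show ?thesis .
    qed
    have cont: "((\<lambda>u. ?\<pi> u z) \<longlongrightarrow> ?\<pi> t z) (at t within {0..t})" if z: "z \<in> S" for z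
    proof -
      have "((\<lambda>u. P (t - u) x z) \<longlongrightarrow> P (t - t) x z) (at t within {0..t})" if "x \<in> S" for x
        using DERIV_continuous[OF dP[OF that z]] by (simp add: continuous_within)
      then have "((\<lambda>u. \<Sum>x\<in>S. \<bar>P (t - u) x z - P 0 x z\<bar>) \<longlongrightarrow> (\<Sum>x\<in>S. \<bar>P (t - t) x z - P 0 x z\<bar>)) (at t within {0..t})"
        by (intro tendsto_sum tendsto_rabs tendsto_diff tendsto_const) auto
      then have "((\<lambda>u. \<Sum>x\<in>S. \<bar>P (t - u) x z - P 0 x z\<bar>) \<longlongrightarrow> 0) (at t within {0..t})"
        by simp
      then have "((\<lambda>u. ?\<pi> u z - ?\<pi> t z) \<longlongrightarrow> 0) (at t within {0..t})"
        by (rule Lim_null_comparison[rotated])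
          (use dist[OF _ z] in \<open>simp add: eventually_at_filter\<close>)
      then show ?thesis by (rule LIM_zero_cancel)
    qed
    have "((\<lambda>u. \<Sum>x\<in>S. ?\<pi> u x * - ((P (t - u) x y - P (t - t) x y) / (u - t)))
        \<longlongrightarrow> (\<Sum>x\<in>S. ?\<pi> t x * - (- generator S q x y))) (at t within {0..t})"
      using dP[OF _ y] unfolding has_field_derivative_iff
      by (intro tendsto_sum tendsto_mult cont tendsto_minus) auto
    moreover have "\<forall>\<^sub>F u in at t within {0..t}.
        (\<Sum>x\<in>S. ?\<pi> u x * - ((P (t - u) x y - P (t - t) x y) / (u - t))) = ?Q u"
    proof -
      have "(\<Sum>x\<in>S. ?\<pi> u x * - ((P (t - u) x y - P (t - t) x y) / (u - t))) = ?Q u"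
        if "u \<in> {0..t}" for u
        using step[of u 0 y] step[of u "t - u" y] that y
        by (simp add: sum_subtractf right_diff_distrib diff_divide_distrib sum_divide_distrib)
      then show ?thesis by (simp add: eventually_at_filter)
    qed
    ultimately show ?thesis
      by (simp add: tendsto_cong)
  qed
  have "{0..t} \<union> {t..} = {0..}" using t by auto
  then have "at t within {0..} = sup (at t within {0..t}) (at t within {t..})"
    by (metis at_within_union)
  then show ?thesis
    using left right unfolding has_field_derivative_iff by (simp add: filterlim_sup)
qed

end

section \<open>Gronwall's inequality and the growth of the expected distance\<close>

lemma gronwall:
  fixes V :: "real \<Rightarrow> real"
  assumes T: "T \<ge> 0" and c: "c \<ge> 0" and e: "e \<ge> 0"
    and der: "\<And>t. 0 \<le> t \<Longrightarrow> t \<le> T \<Longrightarrow> (V has_real_derivative V' t) (at t within {0..})"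
    and le: "\<And>t. 0 \<le> t \<Longrightarrow> t \<le> T \<Longrightarrow> V' t \<le> c * V t + e"
  shows "V T \<le> exp (c * T) * (V 0 + e * T)"
proof -
  \<comment> \<open>Subtracting \<open>e * t\<close> absorbs the forcing term, because the
    integrating factor is at most 1 for \<open>t \<ge> 0\<close>; so \<open>W\<close> does not
    increase.\<close>
  define W where "W t = exp (- (c * t)) * V t - e * t" for t
  have W': "(W has_real_derivative exp (- (c * t)) * (V' t - c * V t) - e) (at t within {0..})"
    if "0 \<le> t" "t \<le> T" for t
    unfolding W_def by (auto intro!: derivative_eq_intros der[OF that] simp: algebra_simps)
  have "W T \<le> W 0"
  proof (rule DERIV_nonpos_imp_decreasing_open[OF T])
    fix t assume t: "0 < t" "t < T"
    have "exp (- (c * t)) * (V' t - c * V t) \<le> exp (- (c * t)) * e"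
      using le[of t] t by (intro mult_left_mono) auto
    also have "\<dots> \<le> 1 * e"
      using c t e by (intro mult_right_mono) auto
    finally have "exp (- (c * t)) * (V' t - c * V t) - e \<le> 0" by simp
    moreover have "at t within {0..} = at t"
      using t by (intro at_within_open_subset[of _ "{0<..}"]) auto
    ultimately show "\<exists>y. (W has_real_derivative y) (at t) \<and> y \<le> 0"
      using W'[of t] t by auto
  next
    have "continuous (at t within {0..}) W" if "t \<in> {0..T}" for t
      using DERIV_continuous[OF W'[of t]] that by auto
    then show "continuous_on {0..T} W"
      unfolding continuous_on_eq_continuous_within
      by (meson continuous_within_subset atLeastAtMost_iff atLeast_iff subsetI)
  qed
  then have "exp (- (c * T)) * V T \<le> V 0 + e * T" by (simp add: W_def)
  then have "exp (c * T) * (exp (- (c * T)) * V T) \<le> exp (c * T) * (V 0 + e * T)"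
    by (intro mult_left_mono) auto
  moreover have "exp (c * T) * (exp (- (c * T)) * V T) = V T"
    by (simp add: exp_minus)
  ultimately show ?thesis by simp
qed

lemma gen_sum: "gen M (\<lambda>k. \<Sum>n\<in>F. f n k) k = (\<Sum>n\<in>F. gen M (f n) k)"
  unfolding gen_def
  by (simp add: sum_subtractf[symmetric] sum_distrib_left sum.swap[of _ _ F] del: sum_subtractf)

lemma abs_le_sqrt_sum: "\<bar>x\<bar> \<le> sqrt (\<delta>\<^sup>2 + x\<^sup>2)"
  by (rule real_le_rsqrt) auto

lemma abs_div_sqrt_le_1: "\<delta> > 0 \<Longrightarrow> \<bar>x / sqrt (\<delta>\<^sup>2 + x\<^sup>2)\<bar> \<le> 1"
  using abs_le_sqrt_sum[of x \<delta>] add_pos_nonneg[of "\<delta>\<^sup>2" "x\<^sup>2"]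
  by (simp add: divide_le_eq_1)

definition smooth_dist :: "real \<Rightarrow> 'a set \<Rightarrow> ('a \<Rightarrow> real) \<Rightarrow> ('a \<Rightarrow> real) \<Rightarrow> real" where
  "smooth_dist \<delta> F u v = (\<Sum>n\<in>F. sqrt (\<delta>\<^sup>2 + (u n - v n)\<^sup>2))"

lemma l1_dist_le_smooth_dist:
  assumes "finite F"
  shows "l1_dist p q \<le> 2 * smooth_dist \<delta> F (pmf p) (pmf q) + 2 * (1 - (\<Sum>n\<in>F. pmf q n))"
proof -
  have "(\<Sum>n\<in>F. \<bar>pmf p n - pmf q n\<bar>) \<le> smooth_dist \<delta> F (pmf p) (pmf q)"
    unfolding smooth_dist_def by (intro sum_mono abs_le_sqrt_sum)
  then show ?thesis using l1_dist_le_truncated[OF assms, of p q] by simp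
qed

text \<open>The subtracted sum is the motion of the solution, weighted by the same slopes as the
  motion of the network. These have size at most 1, so up to O(1/M) only the difference of the two
  drifts counts. The constant 500 doubles to 1000 because the full l1 distance is bounded by twice
  the truncated one plus a tail.\<close>

lemma gen_smooth_dist_le:
  assumes N: "N \<ge> 1" and M: "M \<ge> 1" and \<delta>: "\<delta> > 0" and F: "finite F"
    and tight: "1 - (\<Sum>n\<in>F. pmf q n) \<le> \<epsilon>"
  defines "u \<equiv> \<lambda>k. pmf (contents_pmf M k)"
  shows "gen M (\<lambda>k. smooth_dist \<delta> F (u k) (pmf q)) k
      - (\<Sum>n\<in>F. (u k n - pmf q n) / sqrt (\<delta>\<^sup>2 + (u k n - pmf q n)\<^sup>2) * drift N (map_pmf (scaled N) q) n)
    \<le> 1000 * smooth_dist \<delta> F (u k) (pmf q) + (1000 * \<epsilon> + real (card F) * (100 + 200 / \<delta>) / real M)"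
proof -
  define d where "d n = (u k n - pmf q n) / sqrt (\<delta>\<^sup>2 + (u k n - pmf q n)\<^sup>2)" for n
  define v' where "v' = drift N (map_pmf (scaled N) q)"
  define w where "w = drift N (empirical N M k)"
  have d: "\<bar>d n\<bar> \<le> 1" for n unfolding d_def using \<delta> by (rule abs_div_sqrt_le_1)
  have 1: "gen M (\<lambda>k. sqrt (\<delta>\<^sup>2 + (u k n - pmf q n)\<^sup>2)) k - d n * v' n
      \<le> \<bar>w n - v' n\<bar> + (100 + 200 / \<delta>) / real M" for n
  proof -
    have "gen M (\<lambda>k. sqrt (\<delta>\<^sup>2 + (u k n - pmf q n)\<^sup>2)) k \<le> d n * gen M (\<lambda>k. u k n) k + 200 / (\<delta> * real M)"
      unfolding u_def d_def by (rule gen_sqrt[OF N M \<delta>])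
    then have "gen M (\<lambda>k. sqrt (\<delta>\<^sup>2 + (u k n - pmf q n)\<^sup>2)) k - d n * v' n
        \<le> d n * (gen M (\<lambda>k. u k n) k - v' n) + 200 / (\<delta> * real M)"
      by (simp add: right_diff_distrib)
    also have "d n * (gen M (\<lambda>k. u k n) k - v' n) \<le> \<bar>gen M (\<lambda>k. u k n) k - v' n\<bar>"
      using mult_left_le_one_le[OF abs_ge_zero abs_ge_zero d] abs_ge_self order_trans
      by (metis abs_mult)
    also have "\<dots> \<le> \<bar>w n - v' n\<bar> + 100 / real M"
      using gen_pmf_contents[OF N M, of n k] unfolding u_def w_def by linarith
    finally show ?thesis by (simp add: add_divide_distrib)
  qed
  have "gen M (\<lambda>k. smooth_dist \<delta> F (u k) (pmf q)) k - (\<Sum>n\<in>F. d n * v' n)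
      = (\<Sum>n\<in>F. gen M (\<lambda>k. sqrt (\<delta>\<^sup>2 + (u k n - pmf q n)\<^sup>2)) k - d n * v' n)"
    unfolding smooth_dist_def gen_sum sum_subtractf ..
  also have "\<dots> \<le> (\<Sum>n\<in>F. \<bar>w n - v' n\<bar> + (100 + 200 / \<delta>) / real M)"
    by (intro sum_mono 1)
  also have "\<dots> = (\<Sum>n\<in>F. \<bar>w n - v' n\<bar>) + real (card F) * (100 + 200 / \<delta>) / real M"
    by (simp add: sum.distrib)
  also have "(\<Sum>n\<in>F. \<bar>w n - v' n\<bar>) \<le> 500 * l1_dist (contents_pmf M k) q"
    unfolding w_def v'_def empirical_eq[OF M] by (rule drift_lipschitz[OF N F])
  also have "l1_dist (contents_pmf M k) q \<le> 2 * smooth_dist \<delta> F (u k) (pmf q) + 2 * \<epsilon>"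
    using l1_dist_le_smooth_dist[OF F, of "contents_pmf M k" q \<delta>] tight by (simp add: u_def)
  finally show ?thesis by (simp add: d_def v'_def)
qed

text \<open>The derivative of the expectation has two parts, one from the forward equation and one
  from the motion of \<open>q\<close>. Their sum obeys the bound of
  \<open>gen_smooth_dist_le\<close> in every configuration, hence also on average.\<close>

lemma expected_smooth_dist_le:
  fixes q :: "real \<Rightarrow> (cls \<Rightarrow> nat) pmf"
  assumes N: "N \<ge> 1" and M: "M \<ge> 1" and \<delta>: "\<delta> > 0" and F: "finite F" and \<epsilon>: "\<epsilon> \<ge> 0" and T: "T \<ge> 0"
    and mc: "markov_chain (configs N M) (jump_rate M) \<Omega> X"
    and tight: "\<And>t. 0 \<le> t \<Longrightarrow> t \<le> T \<Longrightarrow> 1 - (\<Sum>n\<in>F. pmf (q t) n) \<le> \<epsilon>"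
    and evol: "\<And>t n. 0 \<le> t \<Longrightarrow> ((\<lambda>u. pmf (q u) n) has_real_derivative
        drift N (map_pmf (scaled N) (q t)) n) (at t within {0..})"
  defines "V \<equiv> \<lambda>t. \<integral>\<omega>. smooth_dist \<delta> F (pmf (contents_pmf M (X t \<omega>))) (pmf (q t)) \<partial>\<Omega>"
  shows "V T \<le> exp (1000 * T) * (V 0 + (1000 * \<epsilon> + real (card F) * (100 + 200 / \<delta>) / real M) * T)"
proof -
  let ?S = "configs N M" and ?\<pi> = "occupation \<Omega> X"
  define u where "u k = pmf (contents_pmf M k)" for k
  define \<Phi> where "\<Phi> t k = smooth_dist \<delta> F (u k) (pmf (q t))" for t k
  define W where "W t = (\<Sum>k\<in>?S. ?\<pi> t k * \<Phi> t k)" for t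
  define \<Phi>' where "\<Phi>' t k = - (\<Sum>n\<in>F. (u k n - pmf (q t) n) / sqrt (\<delta>\<^sup>2 + (u k n - pmf (q t) n)\<^sup>2)
      * drift N (map_pmf (scaled N) (q t)) n)" for t k
  define e where "e = 1000 * \<epsilon> + real (card F) * (100 + 200 / \<delta>) / real M"
  note fin = finite_configs[of N M]
  have VW: "V t = W t" if "t \<ge> 0" for t
    unfolding V_def W_def \<Phi>_def u_def by (rule expectation_chain[OF mc fin that])
  have \<Phi>': "((\<lambda>u. \<Phi> u k) has_real_derivative \<Phi>' t k) (at t within {0..})" if t: "t \<ge> 0" for t k
  proof -
    have "((\<lambda>s. sqrt (\<delta>\<^sup>2 + (u k n - pmf (q s) n)\<^sup>2)) has_real_derivative
        - ((u k n - pmf (q t) n) / sqrt (\<delta>\<^sup>2 + (u k n - pmf (q t) n)\<^sup>2)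
        * drift N (map_pmf (scaled N) (q t)) n)) (at t within {0..})" for n
    proof -
      define w where "w = drift N (map_pmf (scaled N) (q t)) n"
      have "\<delta>\<^sup>2 + (u k n - pmf (q t) n)\<^sup>2 > 0" using \<delta> by (simp add: add_pos_nonneg)
      moreover have "((\<lambda>s. \<delta>\<^sup>2 + (u k n - pmf (q s) n)\<^sup>2) has_real_derivative
          - (2 * (u k n - pmf (q t) n) * w)) (at t within {0..})"
        using evol[OF t, of n, folded w_def]
        by (auto intro!: derivative_eq_intros)
      ultimately have "((\<lambda>s. sqrt (\<delta>\<^sup>2 + (u k n - pmf (q s) n)\<^sup>2)) has_real_derivative
          inverse (sqrt (\<delta>\<^sup>2 + (u k n - pmf (q t) n)\<^sup>2)) / 2 * - (2 * (u k n - pmf (q t) n) * w)) (at t within {0..})"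
        by (intro DERIV_chain2[OF DERIV_real_sqrt])
      moreover have "inverse s / 2 * - (2 * x * w) = - (x / s * w)" for s x :: real
        by (cases "s = 0") (simp_all add: field_simps)
      ultimately show ?thesis by (simp only: w_def)
    qed
    then show ?thesis
      unfolding \<Phi>_def \<Phi>'_def smooth_dist_def sum_negf[symmetric] by (rule DERIV_sum)
  qed
  have W': "(W has_real_derivative (\<Sum>k\<in>?S. ?\<pi> t k * (gen M (\<Phi> t) k + \<Phi>' t k))) (at t within {0..})"
    if t: "t \<ge> 0" for t
  proof -
    have "(W has_real_derivative (\<Sum>y\<in>?S. (\<Sum>x\<in>?S. ?\<pi> t x * generator ?S (jump_rate M) x y) * \<Phi> t y
        + \<Phi>' t y * ?\<pi> t y)) (at t within {0..})"
      unfolding W_def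
      by (intro DERIV_sum DERIV_mult \<Phi>'[OF t] occupation_has_derivative[OF mc fin t])
    \<comment> \<open>Exchanging the sums moves the generator from the law to the function.\<close>
    also have "(\<Sum>y\<in>?S. (\<Sum>x\<in>?S. ?\<pi> t x * generator ?S (jump_rate M) x y) * \<Phi> t y + \<Phi>' t y * ?\<pi> t y)
        = (\<Sum>x\<in>?S. ?\<pi> t x * (\<Sum>y\<in>?S. generator ?S (jump_rate M) x y * \<Phi> t y)) + (\<Sum>y\<in>?S. \<Phi>' t y * ?\<pi> t y)"
      unfolding sum.distrib sum_distrib_left sum_distrib_right
      by (subst sum.swap) (simp add: mult.assoc)
    also have "(\<Sum>x\<in>?S. ?\<pi> t x * (\<Sum>y\<in>?S. generator ?S (jump_rate M) x y * \<Phi> t y))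
        = (\<Sum>x\<in>?S. ?\<pi> t x * gen M (\<Phi> t) x)"
      by (intro sum.cong refl) (simp only: sum_generator_eq_gen)
    also have "\<dots> + (\<Sum>y\<in>?S. \<Phi>' t y * ?\<pi> t y) = (\<Sum>k\<in>?S. ?\<pi> t k * (gen M (\<Phi> t) k + \<Phi>' t k))"
      by (simp add: distrib_left sum.distrib mult.commute)
    finally show ?thesis .
  qed
  have "W T \<le> exp (1000 * T) * (W 0 + e * T)"
  proof (rule gronwall[OF T _ _ W'])
    show "0 \<le> e" using \<epsilon> \<delta> by (simp add: e_def)
    fix t assume t: "0 \<le> t" "t \<le> T"
    have "(\<Sum>k\<in>?S. ?\<pi> t k * (gen M (\<Phi> t) k + \<Phi>' t k)) \<le> (\<Sum>k\<in>?S. ?\<pi> t k * (1000 * \<Phi> t k + e))"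
    proof (intro sum_mono mult_left_mono occupation_nonneg)
      show "gen M (\<Phi> t) k + \<Phi>' t k \<le> 1000 * \<Phi> t k + e" for k
        using gen_smooth_dist_le[OF N M \<delta> F tight[OF t], of k]
        by (simp add: \<Phi>_def[abs_def] \<Phi>'_def u_def e_def)
    qed
    also have "\<dots> = 1000 * W t + (\<Sum>k\<in>?S. ?\<pi> t k) * e"
      unfolding W_def by (simp add: distrib_left sum.distrib sum_distrib_left sum_distrib_right mult.left_commute)
    also have "\<dots> = 1000 * W t + e"
      by (simp add: sum_occupation[OF mc fin t(1)])
    finally show "(\<Sum>k\<in>?S. ?\<pi> t k * (gen M (\<Phi> t) k + \<Phi>' t k)) \<le> 1000 * W t + e" .
  qed auto
  then show ?thesis using T by (simp add: VW e_def)
qed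


section \<open>Tightness of the solution and the weak topology\<close>

text \<open>As in Dini's theorem: a finite set that is good at one time stays good nearby, since
  finite sums of masses are continuous. Compactness leaves finitely many such sets, and their union
  only gains mass.\<close>

lemma uniformly_tight:
  fixes q :: "real \<Rightarrow> 'a pmf"
  assumes cont: "\<And>x. continuous_on {0..T} (\<lambda>t. pmf (q t) x)" and \<epsilon>: "\<epsilon> > 0"
  obtains F where "finite F" "\<And>t. t \<in> {0..T} \<Longrightarrow> 1 - (\<Sum>x\<in>F. pmf (q t) x) \<le> \<epsilon>"
proof -
  have "\<exists>F A. finite F \<and> open A \<and> t \<in> A \<and> (\<forall>s\<in>A \<inter> {0..T}. 1 - \<epsilon> < (\<Sum>x\<in>F. pmf (q s) x))"
    if t: "t \<in> {0..T}" for t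
  proof -
    have "((\<lambda>F. \<Sum>x\<in>F. pmf (q t) x) \<longlongrightarrow> 1) (finite_subsets_at_top UNIV)"
      using infsum_tendsto[OF pmf_summable_on[of "q t" UNIV]] by (simp add: infsum_pmf_UNIV)
    then have "\<forall>\<^sub>F F in finite_subsets_at_top UNIV. 1 - \<epsilon> < (\<Sum>x\<in>F. pmf (q t) x)"
      using \<epsilon> by (intro order_tendstoD) auto
    then obtain F where F: "finite F" "1 - \<epsilon> < (\<Sum>x\<in>F. pmf (q t) x)"
      unfolding eventually_finite_subsets_at_top by blast
    have "continuous_on {0..T} (\<lambda>s. \<Sum>x\<in>F. pmf (q s) x)"
      by (intro continuous_on_sum cont)
    then obtain A where A: "open A" "A \<inter> {0..T} = (\<lambda>s. \<Sum>x\<in>F. pmf (q s) x) -` {1 - \<epsilon><..} \<inter> {0..T}"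
      unfolding continuous_on_open_invariant using open_greaterThan by metis
    have "t \<in> A \<inter> {0..T}" unfolding A(2) using F t by auto
    moreover have "\<forall>s\<in>A \<inter> {0..T}. 1 - \<epsilon> < (\<Sum>x\<in>F. pmf (q s) x)"
      unfolding A(2) by auto
    ultimately show ?thesis using F A by blast
  qed
  then obtain F A where FA: "\<And>t. t \<in> {0..T} \<Longrightarrow> finite (F t)" "\<And>t. t \<in> {0..T} \<Longrightarrow> open (A t)"
    "\<And>t. t \<in> {0..T} \<Longrightarrow> t \<in> A t"
    "\<And>t s. t \<in> {0..T} \<Longrightarrow> s \<in> A t \<Longrightarrow> s \<in> {0..T} \<Longrightarrow> 1 - \<epsilon> < (\<Sum>x\<in>F t. pmf (q s) x)"
    by (metis IntI)
  obtain C where C: "C \<subseteq> {0..T}" "finite C" "{0..T} \<subseteq> (\<Union>t\<in>C. A t)"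
    by (rule compactE_image[OF compact_Icc, of "{0..T}" A 0 T]) (use FA in auto)
  show thesis
  proof
    show fin: "finite (\<Union>t\<in>C. F t)" using C FA by auto
    fix s assume s: "s \<in> {0..T}"
    then obtain t where t: "t \<in> C" "s \<in> A t" using C by auto
    have "1 - \<epsilon> < (\<Sum>x\<in>F t. pmf (q s) x)" using FA(4) s t C by auto
    also have "\<dots> \<le> (\<Sum>x\<in>(\<Union>t\<in>C. F t). pmf (q s) x)"
      using t fin by (intro sum_mono2) auto
    finally show "1 - (\<Sum>x\<in>(\<Union>t\<in>C. F t). pmf (q s) x) \<le> \<epsilon>" by simp
  qed
qed

lemma lattice_pmf_cases:
  assumes "N \<ge> 1" "set_pmf p \<subseteq> range (scaled N)"
  obtains q where "p = map_pmf (scaled N) q"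
proof
  have "map_pmf (scaled N) (map_pmf (inv (scaled N)) p) = p"
    using assms by (auto simp: map_pmf_comp f_inv_into_f intro!: map_pmf_idI)
  then show "p = map_pmf (scaled N) (map_pmf (inv (scaled N)) p)" ..
qed

text \<open>The property passes to finite intersections and to unions, which leaves the generating
  sets. There the expectation of a function bounded by \<open>B\<close> moves by at most
  \<open>B\<close> times the l1 distance.\<close>

lemma weak_open_contains_l1_ball:
  assumes "openin (weak_topology (lattice_top N)) U" "map_pmf (scaled N) q \<in> U"
  shows "\<exists>\<eta>>0. \<forall>p. l1_dist p q < \<eta> \<longrightarrow> map_pmf (scaled N) p \<in> U"
proof -
  have "generate_topology_on {{p. set_pmf p \<subseteq> topspace (lattice_top N) \<and> measure_pmf.expectation p f \<in> U} | f U.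
        bounded_continuous (lattice_top N) f \<and> open U} U"
    using assms(1) by (simp add: weak_topology_def openin_topology_generated_by_iff)
  then show ?thesis using assms(2)
  proof induction
    case Empty
    then show ?case by simp
  next
    case (Int a b)
    then obtain \<eta> \<eta>' where "\<eta> > 0" "\<eta>' > 0"
      "\<And>p. l1_dist p q < \<eta> \<Longrightarrow> map_pmf (scaled N) p \<in> a"
      "\<And>p. l1_dist p q < \<eta>' \<Longrightarrow> map_pmf (scaled N) p \<in> b"
      by auto
    then show ?case by (intro exI[of _ "min \<eta> \<eta>'"]) auto
  next
    case (UN K)
    then obtain k where k: "k \<in> K" "map_pmf (scaled N) q \<in> k" by auto
    from UN.IH[OF this] show ?case using k by blast
  next
    case (Basis s)
    then obtain f U where s: "s = {p. set_pmf p \<subseteq> topspace (lattice_top N) \<and> measure_pmf.expectation p f \<in> U}"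
      and f: "bounded_continuous (lattice_top N) f" and U: "open U" by auto
    have "bounded (f ` range (scaled N))" using f by (simp add: bounded_continuous_def lattice_top_def)
    then obtain B where B: "\<And>n. \<bar>f (scaled N n)\<bar> \<le> B" "B > 0"
      by (auto simp: bounded_pos)
    have "measure_pmf.expectation (map_pmf (scaled N) q) f \<in> U" using Basis s by auto
    with U obtain e where e: "e > 0" "\<And>y. dist y (measure_pmf.expectation (map_pmf (scaled N) q) f) < e \<Longrightarrow> y \<in> U"
      by (auto simp: open_dist)
    have "map_pmf (scaled N) p \<in> s" if p: "l1_dist p q < e / B" for p
    proof -
      have "\<bar>measure_pmf.expectation p (\<lambda>n. f (scaled N n)) - measure_pmf.expectation q (\<lambda>n. f (scaled N n))\<bar>
          \<le> B * l1_dist p q"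
        using B by (intro expectation_diff_le_l1_dist) auto
      also have "\<dots> < e" using p B by (simp add: field_simps)
      finally show ?thesis
        unfolding s using e(2) by (auto simp: lattice_top_def dist_real_def)
    qed
    then show ?case using e B by (intro exI[of _ "e / B"]) auto
  qed
qed

lemma topspace_weak_topology: "topspace (weak_topology T) = {p. set_pmf p \<subseteq> topspace T}"
proof -
  \<comment> \<open>The constant function 0 with \<open>U = UNIV\<close> makes the whole carrier a
    generating set.\<close>
  have "{p. set_pmf p \<subseteq> topspace T} =
      {p. set_pmf p \<subseteq> topspace T \<and> measure_pmf.expectation p (\<lambda>_. 0) \<in> (UNIV :: real set)}" by auto
  moreover have "bounded_continuous T (\<lambda>_. 0)"
    by (auto simp: bounded_continuous_def bounded_iff intro!: exI[of _ 0])
  ultimately have "{p. set_pmf p \<subseteq> topspace T} \<in>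
      {{p. set_pmf p \<subseteq> topspace T \<and> measure_pmf.expectation p f \<in> U} | f U.
        bounded_continuous T f \<and> open U}"
    using open_UNIV by blast
  then show ?thesis
    unfolding weak_topology_def topology_generated_by_topspace by auto
qed

lemma space_borel_of: "space (borel_of T) = topspace T"
  by (simp add: borel_of_def space_measure_of_conv)

lemma sets_borel_of:
  assumes "openin T U"
  shows "U \<in> sets (borel_of T)"
proof -
  have "{U. openin T U} \<subseteq> Pow (topspace T)" by (auto dest: openin_subset)
  with assms show ?thesis unfolding borel_of_def by (simp add: sets_measure_of)
qed

lemma bounded_continuous_measurable:
  assumes "bounded_continuous T f"
  shows "f \<in> borel_measurable (borel_of T)"
proof (rule borel_measurableI)
  fix U :: "real set" assume "open U"
  then have "openin T {x \<in> topspace T. f x \<in> U}"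
    using assms by (auto simp: bounded_continuous_def continuous_map_def)
  moreover have "f -` U \<inter> space (borel_of T) = {x \<in> topspace T. f x \<in> U}"
    by (auto simp: space_borel_of)
  ultimately show "f -` U \<inter> space (borel_of T) \<in> sets (borel_of T)"
    by (simp add: sets_borel_of)
qed

lemma dist_scaled_ge:
  assumes "N \<ge> 1" "n \<noteq> n'"
  shows "1 / real N \<le> dist (scaled N n) (scaled N n')"
proof -
  obtain a where a: "n a \<noteq> n' a" using assms by auto
  have "1 / real N \<le> \<bar>real (n a) - real (n' a)\<bar> / real N"
    using a by (intro divide_right_mono) auto
  also have "\<dots> = dist (scaled N n $ a) (scaled N n' $ a)"
    by (simp add: scaled_def dist_real_def flip: diff_divide_distrib)
  also have "\<dots> \<le> dist (scaled N n) (scaled N n')" by (rule dist_vec_nth_le)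
  finally show ?thesis .
qed

lemma weak_limit_mass:
  assumes N: "N \<ge> 1" and m: "\<And>M. M \<ge> 1 \<Longrightarrow> set_pmf (m M) \<subseteq> range (scaled N)"
    and \<nu>: "set_pmf \<nu> \<subseteq> range (scaled N)"
    and conv: "weakly_converges (lattice_top N) (\<lambda>M. measure_pmf (m M)) (measure_pmf \<nu>)"
  shows "(\<lambda>M. mass N (m M) n) \<longlonglongrightarrow> mass N \<nu> n"
proof -
  \<comment> \<open>A tent of height 1 and radius \<open>1 / N\<close>. Distinct lattice points are
    at least \<open>1 / N\<close> apart, so this continuous function is on the lattice the indicator
    of one point.\<close>
  define f where "f x = max 0 (1 - real N * dist x (scaled N n))" for x
  have f: "f (scaled N n') = indicator {scaled N n} (scaled N n')" for n'
  proof (cases "n' = n")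
    case False
    then have "1 \<le> real N * dist (scaled N n') (scaled N n)"
      using dist_scaled_ge[OF N False] N by (simp add: field_simps)
    then show ?thesis
      using False inj_scaled[OF N] by (auto simp: f_def indicator_def inj_def)
  qed (simp add: f_def)
  have "continuous_on UNIV f" unfolding f_def by (intro continuous_intros)
  moreover have "bounded (range f)"
    by (auto simp: bounded_iff f_def intro!: exI[of _ 1])
  ultimately have "bounded_continuous (lattice_top N) f"
    by (auto simp: bounded_continuous_def lattice_top_def intro: continuous_on_subset bounded_subset)
  with conv have "(\<lambda>M. measure_pmf.expectation (m M) f) \<longlonglongrightarrow> measure_pmf.expectation \<nu> f"
    by (simp add: weakly_converges_def)
  moreover have E: "measure_pmf.expectation p f = mass N p n" if "set_pmf p \<subseteq> range (scaled N)" for p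
  proof -
    have "measure_pmf.expectation p f = measure_pmf.expectation p (indicator {scaled N n})"
      using that f by (intro integral_cong_AE) (auto simp: AE_measure_pmf_iff)
    then show ?thesis by (simp add: mass_def pmf.rep_eq)
  qed
  moreover have "\<forall>\<^sub>F M in sequentially. measure_pmf.expectation (m M) f = mass N (m M) n"
    using eventually_ge_at_top[of 1] by eventually_elim (rule E[OF m])
  ultimately show ?thesis
    using \<nu> by (simp add: tendsto_cong)
qed

section \<open>Vanishing of the expected l1 distance\<close>

lemma expected_l1_dist_tendsto_0:
  fixes q :: "real \<Rightarrow> (cls \<Rightarrow> nat) pmf"
  assumes N: "N \<ge> 1" and T: "T \<ge> 0"
    and X: "\<And>M. M \<ge> 1 \<Longrightarrow> network_process N M (m M) (\<Omega> M) (X M)"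
    and init: "\<And>n. (\<lambda>M. mass N (m M) n) \<longlonglongrightarrow> pmf (q 0) n"
    and evol: "\<And>t n. 0 \<le> t \<Longrightarrow> ((\<lambda>u. pmf (q u) n) has_real_derivative
        drift N (map_pmf (scaled N) (q t)) n) (at t within {0..})"
  shows "(\<lambda>M. \<integral>\<omega>. l1_dist (contents_pmf M (X M T \<omega>)) (q T) \<partial>\<Omega> M) \<longlonglongrightarrow> 0"
proof (rule tendstoI)
  fix \<eta> :: real assume \<eta>: "\<eta> > 0"
  let ?D = "\<lambda>M. \<integral>\<omega>. l1_dist (contents_pmf M (X M T \<omega>)) (q T) \<partial>\<Omega> M"
  define K where "K = exp (1000 * T)"
  have K: "K > 0" by (simp add: K_def)
  \<comment> \<open>Solves \<open>2 * K * (1000 * \<epsilon> * T) + 2 * \<epsilon> = \<eta> /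
    3\<close>: the tail error after Gronwall, plus the tail in the truncation bound at time
    \<open>T\<close>.\<close>
  define \<epsilon> where "\<epsilon> = \<eta> / (3 * (2 * K * 1000 * T + 2))"
  have pos: "2 * K * 1000 * T + 2 > 0" using K T by (intro add_nonneg_pos) auto
  have "\<eta> / (3 * a) * a = \<eta> / 3" if "a > 0" for a :: real
    using that by simp
  from this[OF pos] have "\<epsilon> * (2 * K * 1000 * T + 2) = \<eta> / 3"
    unfolding \<epsilon>_def .
  then have \<epsilon>': "2 * K * (1000 * \<epsilon> * T) + 2 * \<epsilon> = \<eta> / 3"
    by (simp only: distrib_left mult.commute mult.left_commute)
  have \<epsilon>: "\<epsilon> > 0"
    using \<eta> pos by (simp add: \<epsilon>_def)
  have "continuous_on {0..T} (\<lambda>t. pmf (q t) n)" for n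
  proof -
    have "continuous_on {0..} (\<lambda>t. pmf (q t) n)"
      using DERIV_continuous[OF evol] by (auto simp: continuous_on_eq_continuous_within)
    then show ?thesis by (rule continuous_on_subset) auto
  qed
  then obtain F where F: "finite F" and tight: "\<And>t. t \<in> {0..T} \<Longrightarrow> 1 - (\<Sum>n\<in>F. pmf (q t) n) \<le> \<epsilon>"
    using uniformly_tight[of T q \<epsilon>] \<epsilon> by blast
  \<comment> \<open>The added 1 keeps the denominator of \<delta> positive when \<open>F\<close> is
    empty.\<close>
  define c where "c = real (card F) + 1"
  have c: "c > 0" by (simp add: c_def)
  \<comment> \<open>Even for equal masses the smoothed distance is \<open>card F * \<delta>\<close>;
    magnified by \<open>2 * K\<close> it has to stay below \<open>\<eta> / 2\<close>.\<close>
  define \<delta> where "\<delta> = \<eta> / (6 * K * c)"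
  have \<delta>: "\<delta> > 0" using \<eta> K c by (simp add: \<delta>_def)
  have \<delta>': "2 * K * (real (card F) * \<delta>) < \<eta> / 2"
  proof -
    have "2 * K * (real (card F) * \<delta>) \<le> 2 * K * (c * \<delta>)"
      using K \<delta> by (intro mult_left_mono mult_right_mono) (auto simp: c_def)
    also have "\<dots> = \<eta> / 3"
      using K c by (simp add: \<delta>_def)
    also have "\<dots> < \<eta> / 2" using \<eta> by simp
    finally show ?thesis .
  qed
  \<comment> \<open>\<open>F\<close> and \<delta> are fixed by now, so as \<open>M\<close> grows the
    sum over \<open>F\<close> tends to \<open>card F * \<delta>\<close> and the quotient by
    \<open>M\<close> to 0.\<close>
  define R where "R M = 2 * (K * ((\<Sum>n\<in>F. sqrt (\<delta>\<^sup>2 + (mass N (m M) n - pmf (q 0) n)\<^sup>2))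
      + (1000 * \<epsilon> + real (card F) * (100 + 200 / \<delta>) / real M) * T)) + 2 * \<epsilon>" for M
  have le: "?D M \<le> R M" if M: "M \<ge> 1" for M
  proof -
    have mc: "markov_chain (configs N M) (jump_rate M) (\<Omega> M) (X M)"
      and ae: "AE \<omega> in \<Omega> M. empirical N M (X M 0 \<omega>) = m M"
      using X[OF M] by (auto simp: network_process_def)
    interpret prob_space "\<Omega> M" using mc by (simp add: markov_chain_def)
    let ?\<pi> = "occupation (\<Omega> M) (X M)"
    define V where "V t = (\<integral>\<omega>. smooth_dist \<delta> F (pmf (contents_pmf M (X M t \<omega>))) (pmf (q t)) \<partial>\<Omega> M)" for t
    note E = expectation_chain[OF mc finite_configs]
    \<comment> \<open>The initial configuration may be random, but the distance depends on it only
      through the empirical measure, which is almost surely fixed.\<close>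
    have "AE \<omega> in \<Omega> M. smooth_dist \<delta> F (pmf (contents_pmf M (X M 0 \<omega>))) (pmf (q 0))
        = (\<Sum>n\<in>F. sqrt (\<delta>\<^sup>2 + (mass N (m M) n - pmf (q 0) n)\<^sup>2))"
      using ae
    proof eventually_elim
      case (elim \<omega>)
      have "pmf (contents_pmf M (X M 0 \<omega>)) n = mass N (m M) n" for n
        unfolding elim[symmetric] empirical_eq[OF M] mass_map_scaled[OF N] ..
      then show ?case by (simp add: smooth_dist_def)
    qed
    then have "V 0 = (\<integral>\<omega>. (\<Sum>n\<in>F. sqrt (\<delta>\<^sup>2 + (mass N (m M) n - pmf (q 0) n)\<^sup>2)) \<partial>\<Omega> M)"
      unfolding V_def
      by (intro integral_cong_AE measurable_compose[OF chain_measurable[OF mc finite_configs]]) auto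
    then have V0: "V 0 = (\<Sum>n\<in>F. sqrt (\<delta>\<^sup>2 + (mass N (m M) n - pmf (q 0) n)\<^sup>2))"
      by (simp add: prob_space)
    have VT: "V T \<le> K * (V 0 + (1000 * \<epsilon> + real (card F) * (100 + 200 / \<delta>) / real M) * T)"
      unfolding V_def K_def
      by (rule expected_smooth_dist_le[OF N M \<delta> F _ T mc _ evol]) (use tight \<epsilon> in auto)
    have "?D M = (\<Sum>k\<in>configs N M. ?\<pi> T k * l1_dist (contents_pmf M k) (q T))"
      by (rule E[OF T])
    also have "\<dots> \<le> (\<Sum>k\<in>configs N M. ?\<pi> T k *
        (2 * smooth_dist \<delta> F (pmf (contents_pmf M k)) (pmf (q T)) + 2 * \<epsilon>))"
    proof (intro sum_mono mult_left_mono occupation_nonneg)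
      show "l1_dist (contents_pmf M k) (q T) \<le> 2 * smooth_dist \<delta> F (pmf (contents_pmf M k)) (pmf (q T)) + 2 * \<epsilon>" for k
        using l1_dist_le_smooth_dist[OF F, of "contents_pmf M k" "q T" \<delta>] tight[of T] T by simp
    qed
    also have "\<dots> = 2 * (\<Sum>k\<in>configs N M. ?\<pi> T k * smooth_dist \<delta> F (pmf (contents_pmf M k)) (pmf (q T)))
        + (\<Sum>k\<in>configs N M. ?\<pi> T k) * (2 * \<epsilon>)"
      by (simp add: distrib_left sum.distrib sum_distrib_left sum_distrib_right mult.left_commute)
    also have "(\<Sum>k\<in>configs N M. ?\<pi> T k * smooth_dist \<delta> F (pmf (contents_pmf M k)) (pmf (q T))) = V T"
      unfolding V_def by (rule E[OF T, symmetric])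
    also have "(\<Sum>k\<in>configs N M. ?\<pi> T k) = 1"
      by (rule sum_occupation[OF mc finite_configs T])
    finally show ?thesis using VT unfolding V0 R_def by simp
  qed
  have "R \<longlonglongrightarrow> 2 * (K * ((\<Sum>n\<in>F. sqrt (\<delta>\<^sup>2 + (pmf (q 0) n - pmf (q 0) n)\<^sup>2)) + (1000 * \<epsilon> + 0) * T)) + 2 * \<epsilon>"
    unfolding R_def[abs_def]
    by (intro tendsto_intros init lim_const_over_n)
  moreover have "2 * (K * ((\<Sum>n\<in>F. sqrt (\<delta>\<^sup>2 + (pmf (q 0) n - pmf (q 0) n)\<^sup>2)) + (1000 * \<epsilon> + 0) * T)) + 2 * \<epsilon> < \<eta>"
    using \<epsilon>' \<delta>' \<delta> \<eta> by (simp add: algebra_simps)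
  ultimately have "\<forall>\<^sub>F M in sequentially. R M < \<eta>"
    by (rule order_tendstoD)
  then show "\<forall>\<^sub>F M in sequentially. dist (?D M) 0 < \<eta>"
    using eventually_ge_at_top[of 1]
  proof eventually_elim
    case (elim M)
    have "0 \<le> ?D M" by (intro Bochner_Integration.integral_nonneg l1_dist_nonneg)
    then show ?case using le[of M] elim by simp
  qed
qed

section \<open>From the expected distance to weak convergence of the laws\<close>

theorem mainTheorem2:
  fixes N :: nat
    and m :: "nat \<Rightarrow> (real ^ cls) pmf"
    and \<Omega> :: "nat \<Rightarrow> 'w measure"
    and X :: "nat \<Rightarrow> real \<Rightarrow> 'w \<Rightarrow> config"
    and \<nu>\<^sub>0 :: "(real ^ cls) pmf"
    and \<nu> :: "real \<Rightarrow> (real ^ cls) pmf"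
  assumes "N \<ge> 1"
    and "\<And>M. M \<ge> 1 \<Longrightarrow> m M \<in> empirical_measures N M"
    and "\<And>M. M \<ge> 1 \<Longrightarrow> network_process N M (m M) (\<Omega> M) (X M)"
    and "set_pmf \<nu>\<^sub>0 \<subseteq> range (scaled N)"
    and "weakly_converges (lattice_top N) (\<lambda>M. measure_pmf (m M)) (measure_pmf \<nu>\<^sub>0)"
    and "nonlinear_evolution N \<nu>\<^sub>0 \<nu>"
  shows "\<forall>t\<ge>0. weakly_converges (weak_topology (lattice_top N))
           (\<lambda>M. network_law N M (\<Omega> M) (X M) t)
           (return (borel_of (weak_topology (lattice_top N))) (\<nu> t))"
proof (intro allI impI)
  fix t :: real assume t: "t \<ge> 0"
  note N = assms(1) and X = assms(3)
  let ?W = "weak_topology (lattice_top N)"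
  have topW: "topspace ?W = {p. set_pmf p \<subseteq> range (scaled N)}"
    by (simp add: topspace_weak_topology lattice_top_def)
  have "\<exists>p. \<nu> s = map_pmf (scaled N) p" if "s \<ge> 0" for s
    using assms(6) that lattice_pmf_cases[OF N, of "\<nu> s"] unfolding nonlinear_evolution_def by metis
  then obtain q where q: "\<And>s. s \<ge> 0 \<Longrightarrow> \<nu> s = map_pmf (scaled N) (q s)" by metis
  have mass_\<nu>: "mass N (\<nu> s) n = pmf (q s) n" if "s \<ge> 0" for s n
    using q[OF that] by (simp add: mass_map_scaled[OF N])
  have evol: "((\<lambda>u. pmf (q u) n) has_real_derivative drift N (map_pmf (scaled N) (q s)) n) (at s within {0..})"
    if s: "s \<ge> 0" for s n
  proof -
    have "((\<lambda>u. mass N (\<nu> u) n) has_real_derivative drift N (\<nu> s) n) (at s within {0..})"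
      using assms(6) s by (simp add: nonlinear_evolution_def)
    \<comment> \<open>\<open>q\<close> represents the solution at nonnegative times only, so the
      derivative is transferred within \<open>{0..}\<close>.\<close>
    then show ?thesis
      unfolding q[OF s] by (rule has_field_derivative_transform_within[of _ _ _ _ 1]) (use s mass_\<nu> in auto)
  qed
  have init: "(\<lambda>M. mass N (m M) n) \<longlonglongrightarrow> pmf (q 0) n" for n
  proof -
    have "set_pmf (m M) \<subseteq> range (scaled N)" if "M \<ge> 1" for M
      using assms(2)[OF that] that by (auto simp: empirical_measures_def empirical_eq)
    then have "(\<lambda>M. mass N (m M) n) \<longlonglongrightarrow> mass N \<nu>\<^sub>0 n"
      by (intro weak_limit_mass N assms(4,5))
    moreover have "\<nu>\<^sub>0 = \<nu> 0" using assms(6) by (simp add: nonlinear_evolution_def)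
    ultimately show ?thesis by (simp add: mass_\<nu>)
  qed
  have D: "(\<lambda>M. \<integral>\<omega>. l1_dist (contents_pmf M (X M t \<omega>)) (q t) \<partial>\<Omega> M) \<longlonglongrightarrow> 0"
    by (rule expected_l1_dist_tendsto_0[OF N t X init evol])
  show "weakly_converges ?W (\<lambda>M. network_law N M (\<Omega> M) (X M) t) (return (borel_of ?W) (\<nu> t))"
    unfolding weakly_converges_def
  proof (intro allI impI)
    fix f :: "(real ^ cls) pmf \<Rightarrow> real" assume f: "bounded_continuous ?W f"
    note meas = bounded_continuous_measurable[OF f]
    have "\<nu> t \<in> space (borel_of ?W)"
      using q[OF t] by (auto simp: space_borel_of topW)
    then have lim: "(\<integral>x. f x \<partial>return (borel_of ?W) (\<nu> t)) = f (\<nu> t)"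
      using meas by (rule integral_return)
    have "bounded (f ` topspace ?W)"
      using f by (simp add: bounded_continuous_def)
    then obtain B where "B > 0" "\<forall>p\<in>topspace ?W. \<bar>f p\<bar> \<le> B"
      unfolding bounded_pos by auto
    moreover have "map_pmf (scaled N) p \<in> topspace ?W" for p
      by (auto simp: topW)
    ultimately have B: "B > 0" "\<And>p. \<bar>f (map_pmf (scaled N) p)\<bar> \<le> B"
      by simp_all
    have "(\<lambda>M. \<integral>x. f x \<partial>network_law N M (\<Omega> M) (X M) t) \<longlonglongrightarrow> f (\<nu> t)"
    proof (rule tendstoI)
      fix e :: real assume e: "e > 0"
      have "openin ?W {p \<in> topspace ?W. f p \<in> ball (f (\<nu> t)) (e / 2)}"
        using f open_ball[of "f (\<nu> t)" "e / 2"]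
        unfolding bounded_continuous_def continuous_map_def open_openin[symmetric] by blast
      moreover have "map_pmf (scaled N) (q t) \<in> {p \<in> topspace ?W. f p \<in> ball (f (\<nu> t)) (e / 2)}"
        using e q[OF t] by (auto simp: topW)
      ultimately have "\<exists>\<eta>>0. \<forall>p. l1_dist p (q t) < \<eta> \<longrightarrow>
          map_pmf (scaled N) p \<in> {p \<in> topspace ?W. f p \<in> ball (f (\<nu> t)) (e / 2)}"
        by (rule weak_open_contains_l1_ball)
      then obtain \<eta> where \<eta>: "\<eta> > 0"
        "\<And>p. l1_dist p (q t) < \<eta> \<Longrightarrow> f (map_pmf (scaled N) p) \<in> ball (f (\<nu> t)) (e / 2)"
        by blast
      \<comment> \<open>Markov's inequality in pointwise form: near the limit, continuity gives
        \<open>e / 2\<close>; farther away the trivial bound \<open>2 * B\<close> is at most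
        \<open>2 * B / \<eta>\<close> times the distance. In this form it can be averaged over the
        configurations at once.\<close>
      have bd: "\<bar>f (map_pmf (scaled N) p) - f (\<nu> t)\<bar> \<le> e / 2 + 2 * B / \<eta> * l1_dist p (q t)" for p
      proof (cases "l1_dist p (q t) < \<eta>")
        case True
        then have "\<bar>f (map_pmf (scaled N) p) - f (\<nu> t)\<bar> < e / 2"
          using \<eta>(2)[of p] by (simp add: dist_real_def abs_minus_commute)
        moreover have "0 \<le> 2 * B / \<eta> * l1_dist p (q t)"
          using B \<eta> l1_dist_nonneg[of p "q t"] by simp
        ultimately show ?thesis by linarith
      next
        case False
        have "\<bar>f (map_pmf (scaled N) p) - f (\<nu> t)\<bar> \<le> 2 * B"
          using B(2)[of p] B(2)[of "q t"] q[OF t] by simp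
        also have "\<dots> = 2 * B / \<eta> * \<eta>" using \<eta> by simp
        also have "\<dots> \<le> 2 * B / \<eta> * l1_dist p (q t)"
          using False B \<eta> by (intro mult_left_mono) auto
        finally show ?thesis using e by linarith
      qed
      \<comment> \<open>The threshold makes the averaged second term of \<open>bd\<close> smaller
        than \<open>e / 2\<close>.\<close>
      have "\<forall>\<^sub>F M in sequentially. (\<integral>\<omega>. l1_dist (contents_pmf M (X M t \<omega>)) (q t) \<partial>\<Omega> M) < e / 2 / (2 * B / \<eta>)"
        using D e B \<eta> by (intro order_tendstoD) auto
      then show "\<forall>\<^sub>F M in sequentially. dist (\<integral>x. f x \<partial>network_law N M (\<Omega> M) (X M) t) (f (\<nu> t)) < e"
        using eventually_ge_at_top[of 1]
      proof eventually_elim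
        case (elim M)
        then have M: "M \<ge> 1" by simp
        have mc: "markov_chain (configs N M) (jump_rate M) (\<Omega> M) (X M)"
          using X[OF M] by (simp add: network_process_def)
        let ?S = "configs N M" and ?\<pi> = "occupation (\<Omega> M) (X M) t"
        note E = expectation_chain[OF mc finite_configs t] and one = sum_occupation[OF mc finite_configs t]
        \<comment> \<open>On the discrete state set every map into the carrier is
          measurable.\<close>
        have "(\<lambda>\<omega>. empirical N M (X M t \<omega>)) \<in> measurable (\<Omega> M) (borel_of ?W)"
          by (rule measurable_compose[OF chain_measurable[OF mc finite_configs t]])
            (auto simp: space_borel_of topW empirical_eq[OF M])
        then have "(\<integral>x. f x \<partial>network_law N M (\<Omega> M) (X M) t) = (\<integral>\<omega>. f (empirical N M (X M t \<omega>)) \<partial>\<Omega> M)"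
          unfolding network_law_def using meas by (rule integral_distr)
        also have "\<dots> = (\<Sum>k\<in>?S. ?\<pi> k * f (map_pmf (scaled N) (contents_pmf M k)))"
          unfolding empirical_eq[OF M] by (rule E)
        finally have "(\<integral>x. f x \<partial>network_law N M (\<Omega> M) (X M) t) - f (\<nu> t)
            = (\<Sum>k\<in>?S. ?\<pi> k * (f (map_pmf (scaled N) (contents_pmf M k)) - f (\<nu> t)))"
          using one by (simp add: right_diff_distrib sum_subtractf flip: sum_distrib_right)
        then have "dist (\<integral>x. f x \<partial>network_law N M (\<Omega> M) (X M) t) (f (\<nu> t))
            = \<bar>\<Sum>k\<in>?S. ?\<pi> k * (f (map_pmf (scaled N) (contents_pmf M k)) - f (\<nu> t))\<bar>"
          by (simp only: dist_real_def)
        also have "\<dots> \<le> (\<Sum>k\<in>?S. ?\<pi> k * (e / 2 + 2 * B / \<eta> * l1_dist (contents_pmf M k) (q t)))"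
        proof (intro order_trans[OF sum_abs] sum_mono)
          show "\<bar>?\<pi> k * (f (map_pmf (scaled N) (contents_pmf M k)) - f (\<nu> t))\<bar>
              \<le> ?\<pi> k * (e / 2 + 2 * B / \<eta> * l1_dist (contents_pmf M k) (q t))" for k
            unfolding abs_mult using bd[of "contents_pmf M k"] occupation_nonneg[of "\<Omega> M" "X M" t k]
            by (simp add: mult_left_mono)
        qed
        also have "\<dots> = (\<Sum>k\<in>?S. ?\<pi> k) * (e / 2)
            + 2 * B / \<eta> * (\<Sum>k\<in>?S. ?\<pi> k * l1_dist (contents_pmf M k) (q t))"
          unfolding distrib_left sum.distrib sum_distrib_left sum_distrib_right
          by (simp add: mult.left_commute)
        also have "\<dots> = e / 2 + 2 * B / \<eta> * (\<integral>\<omega>. l1_dist (contents_pmf M (X M t \<omega>)) (q t) \<partial>\<Omega> M)"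
          unfolding one E[where h="\<lambda>k. l1_dist (contents_pmf M k) (q t)"] by simp
        also have "\<dots> < e / 2 + 2 * B / \<eta> * (e / 2 / (2 * B / \<eta>))"
          using elim B \<eta> by (intro add_strict_left_mono mult_strict_left_mono) auto
        also have "\<dots> = e" using B \<eta> by simp
        finally show ?case .
      qed
    qed
    then show "(\<lambda>M. \<integral>x. f x \<partial>network_law N M (\<Omega> M) (X M) t) \<longlonglongrightarrow> (\<integral>x. f x \<partial>return (borel_of ?W) (\<nu> t))"
      unfolding lim .
  qed
qed

end
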